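(* Let $X=(X_t)_{t\ge 0}$ be a conservative regular one-dimensional diffusion on an interval $I\subseteq\mathbb{R}$ with $0\in I$, with speed measure $m$ and Green kernel $G_\lambda$. Let $I^+:=I\cap[0,\infty)$, $A_t:=\mathrm{Leb}\{s\in[0,t]:X_s\ge0\}$, and for $\lambda>0$, $n\ge 1$ let $$\widehat A_0(\lambda;n):=\int_0^\infty \mathrm{e}^{-\lambda t}\,\mathbf{E}_0(A_t^n)\,\mathrm{d}t .$$ Then for every $\lambda>0$, for $n=1$, $$\widehat A_0(\lambda;1)=\frac1\lambda\int_{I^+}G_\lambda(0,y)\,m(\mathrm{d}y),$$ and for $n=2,3,\dots$, $$\widehat A_0(\lambda;n)=\frac{n!}{\lambda^{n-1}}\widehat A_0(\lambda;1)+\frac{n!}{\lambda^{n+1}}\sum_{k=1}^{n-1}\left(1-\frac{\lambda^{n-k+1}}{(n-k)!}\widehat A_0(\lambda;n-k)\right)D_k(\lambda),$$ where $$D_k(\lambda):=\frac{(-\lambda)^k}{(k-1)!}\int_{I^+}G_\lambda(0,y)\,\widehat f^{(k-1)}_\lambda(y;\lambda)\,m(\mathrm{d}y),$$ with $\widehat f(y;\lambda):=\mathbf{E}_y(\mathrm{e}^{-\lambda H_0})$ and $\widehat f^{(k)}_\lambda(y;\lambda):=\frac{\mathrm{d}^k}{\mathrm{d}\lambda^k}\widehat f(y;\lambda)$. Moreover, if $X$ has the scaling property that for every $a\ge0$ there exists $b\ge0$ such that $(X_{at})_{t\ge0}\overset{(d)}{=}(bX_t)_{t\ge0}$ for $X$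 started at $0$, then for all $\lambda>0$, $$\mathbf{E}_0(A_1)=\lambda\int_{I^+}G_\lambda(0,y)\,m(\mathrm{d}y),$$ and, for all $n\ge1$ and all $\lambda>0$, $$\mathbf{E}_0(A_1^n)=\mathbf{E}_0(A_1)+\sum_{k=1}^{n-1}\left(1-\mathbf{E}_0(A_1^{n-k})\right)D_k(\lambda).$$
   Context: $X$ is a regular diffusion (a continuous strong Markov process that reaches every point of $I$ from every point of $I$ with positive probability) taking values in an interval $I\subseteq\mathbb{R}$ with $0\in I$. It is conservative: $\mathbf{P}_x(X_t\in I)=1$ for all $x\in I$, $t\ge0$, where $\mathbf{P}_x$ (expectation $\mathbf{E}_x$) is the law of $X$ started at $x$. Its speed measure is $m$ and its scale function $S$ is normalized by $S(0)=0$. $X$ has a transition density $p$ with respect to $m$: $\mathbf{P}_x(X_t\in B)=\int_B p(t;x,y)\,m(\mathrm{d}y)$ for Borel $B\subseteq I$. The Green kernel is $G_\lambda(x,y)=\int_0^\infty \mathrm{e}^{-\lambda t}p(t;x,y)\,\mathrm{d}t$ for $\lambda>0$; equivalently $G_\lambda(x,y)=w_\lambda^{-1}\psi_\lambda(x)\varphi_\lambda(y)$ for $x\le y$ and $G_\lambda(x,y)=w_\lambda^{-1}\psi_\lambda(y)\varphi_\lambda(x)$ for $x\ge y$, where $\psi_\lambda$ (increasing) and $\varphi_\lambda$ (decreasing) are the positive continuous solutions of $\frac{d}{dm}\frac{d}{dS}u=\lambda u$ satisfying the appropriate boundary conditions, and $w_\lambda$ is their Wronskian with respect to $S$. The first hitting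 time is $H_0:=\inf\{t\ge0:X_t=0\}$, with $\mathrm{e}^{-\lambda H_0}:=0$ on $\{H_0=\infty\}$. $\mathrm{Leb}$ is Lebesgue measure; $\overset{(d)}{=}$ is equality in distribution of processes. Empty sums are $0$. *)

theory Defs
  imports "HOL-Probability.Probability"
begin

text \<open>
  A process with real state space is a function \<open>X :: real \<Rightarrow> 'w \<Rightarrow> real\<close>, of which only
  the times \<open>t \<ge> 0\<close> matter; \<open>P x\<close> is the probability measure under which \<open>X\<close> starts at \<open>x\<close>.
\<close>

text \<open>The infimum over the empty set is \<open>\<infinity>\<close> in \<^typ>\<open>ennreal\<close>.\<close>

definition hitting_time :: "(real \<Rightarrow> 'w \<Rightarrow> real) \<Rightarrow> real \<Rightarrow> 'w \<Rightarrow> ennreal" where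
  "hitting_time X y \<omega> = Inf {ennreal t | t. 0 \<le> t \<and> X t \<omega> = y}"

definition path_space :: "(real \<Rightarrow> real) measure" where
  "path_space = Pi\<^sub>M {0..} (\<lambda>_. borel)"

text \<open>
  There is no cemetery state: the process is conservative because every path
  stays in \<open>I\<close> for all times. The strong Markov property is stated
  without shift operators, through the law of the path after the stopping time \<open>T\<close>:
  \<open>P\<^sub>x(A, T < \<infinity>, (X\<^sub>T\<^sub>+\<^sub>s)\<^sub>s \<in> B) = E\<^sub>x(P\<^bsub>X\<^sub>T\<^esub>(X \<in> B); A, T < \<infinity>)\<close> for \<open>A\<close> in
  the sigma-algebra of \<open>T\<close>. The filtration is indexed by \<open>[0,\<infinity>]\<close>, and stopping times may take the
  value \<open>\<infinity>\<close>. Any filtration to which \<open>X\<close> is adapted is allowed, in particular the natural one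
  and its right-continuous version.
\<close>

locale regular_diffusion = filtration "space M" F
  for M :: "'w measure" and F :: "ennreal \<Rightarrow> 'w measure" +
  fixes I :: "real set"
    and P :: "real \<Rightarrow> 'w measure"
    and X :: "real \<Rightarrow> 'w \<Rightarrow> real"
  assumes interval: "is_interval I" "interior I \<noteq> {}"
    and sub_sigma: "\<And>t. sets (F t) \<subseteq> sets M"
    and adapted: "\<And>t. 0 \<le> t \<Longrightarrow> X t \<in> borel_measurable (F (ennreal t))"
    and kernel: "P \<in> restrict_space borel I \<rightarrow>\<^sub>M prob_algebra M"
    and start: "\<And>x. x \<in> I \<Longrightarrow> emeasure (P x) {\<omega> \<in> space M. X 0 \<omega> = x} = 1"
    and conservative: "\<And>\<omega> t. \<omega> \<in> space M \<Longrightarrow> 0 \<le> t \<Longrightarrow> X t \<omega> \<in> I"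
    and continuous_paths: "\<And>\<omega>. \<omega> \<in> space M \<Longrightarrow> continuous_on {0..} (\<lambda>t. X t \<omega>)"
    and strong_Markov: "\<And>x T A B. x \<in> I \<Longrightarrow> stopping_time F T \<Longrightarrow> A \<in> sets (pre_sigma T)
        \<Longrightarrow> B \<in> sets path_space
        \<Longrightarrow> emeasure (P x) {\<omega> \<in> A. T \<omega> < \<infinity> \<and> (\<lambda>s\<in>{0..}. X (enn2real (T \<omega>) + s) \<omega>) \<in> B}
          = (\<integral>\<^sup>+\<omega>\<in>{\<omega> \<in> A. T \<omega> < \<infinity>}.
               emeasure (P (X (enn2real (T \<omega>)) \<omega>)) {\<omega>' \<in> space M. (\<lambda>s\<in>{0..}. X s \<omega>') \<in> B} \<partial>P x)"
    and regular: "\<And>x y. x \<in> I \<Longrightarrow> y \<in> I \<Longrightarrow> emeasure (P x) {\<omega> \<in> space M. hitting_time X y \<omega> < \<infinity>} > 0"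

definition scale_function ::
  "real set \<Rightarrow> (real \<Rightarrow> 'w measure) \<Rightarrow> (real \<Rightarrow> 'w \<Rightarrow> real) \<Rightarrow> (real \<Rightarrow> real) \<Rightarrow> bool" where
  "scale_function I P X S \<longleftrightarrow>
     continuous_on I S \<and> strict_mono_on I S \<and>
     (\<forall>a\<in>I. \<forall>b\<in>I. \<forall>x. a < x \<and> x < b \<longrightarrow>
        measure (P x) {\<omega> \<in> space (P x). hitting_time X a \<omega> < hitting_time X b \<omega>}
          = (S b - S x) / (S b - S a))"

text \<open>
  The speed measure is determined by the expected exit times, through the Green functions
  of \<open>d/dm d/dS\<close> (no factor \<open>1/2\<close>: Brownian motion with \<open>S x = x\<close> has \<open>m(dx) = 2 dx\<close>). The first
  formula determines \<open>m\<close> in the interior of \<open>I\<close>. An endpoint of \<open>I\<close> that belongs to \<open>I\<close> is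
  reflecting, by regularity, possibly sticky; the last two formulas determine the mass of \<open>m\<close> there.
  As a measure on the line, \<open>m\<close> is carried by \<open>I\<close>.
\<close>

definition speed_measure ::
  "real set \<Rightarrow> (real \<Rightarrow> 'w measure) \<Rightarrow> (real \<Rightarrow> 'w \<Rightarrow> real) \<Rightarrow> (real \<Rightarrow> real) \<Rightarrow> real measure \<Rightarrow> bool" where
  "speed_measure I P X S m \<longleftrightarrow>
     sets m = sets borel \<and> emeasure m (- I) = 0 \<and>
     (\<forall>a\<in>I. \<forall>b\<in>I. a < b \<longrightarrow> 0 < emeasure m {a<..<b} \<and> emeasure m {a..b} < \<infinity>) \<and>
     (\<forall>a\<in>I. \<forall>b\<in>I. \<forall>x. a < x \<and> x < b \<longrightarrow>
        (\<integral>\<^sup>+\<omega>. min (hitting_time X a \<omega>) (hitting_time X b \<omega>) \<partial>P x)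
          = (\<integral>\<^sup>+y\<in>{a<..<b}. ennreal ((S (min x y) - S a) * (S b - S (max x y)) / (S b - S a)) \<partial>m)) \<and>
     (\<forall>l\<in>I. (\<forall>z\<in>I. l \<le> z) \<longrightarrow> (\<forall>b\<in>I. \<forall>x. l \<le> x \<and> x < b \<longrightarrow>
        (\<integral>\<^sup>+\<omega>. hitting_time X b \<omega> \<partial>P x) = (\<integral>\<^sup>+y\<in>{l..<b}. ennreal (S b - S (max x y)) \<partial>m))) \<and>
     (\<forall>r\<in>I. (\<forall>z\<in>I. z \<le> r) \<longrightarrow> (\<forall>a\<in>I. \<forall>x. a < x \<and> x \<le> r \<longrightarrow>
        (\<integral>\<^sup>+\<omega>. hitting_time X a \<omega> \<partial>P x) = (\<integral>\<^sup>+y\<in>{a<..r}. ennreal (S (min x y) - S a) \<partial>m)))"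

definition transition_density ::
  "real set \<Rightarrow> (real \<Rightarrow> 'w measure) \<Rightarrow> (real \<Rightarrow> 'w \<Rightarrow> real) \<Rightarrow> real measure
     \<Rightarrow> (real \<Rightarrow> real \<Rightarrow> real \<Rightarrow> real) \<Rightarrow> bool" where
  "transition_density I P X m p \<longleftrightarrow>
     (\<lambda>(t, x, y). p t x y) \<in> borel_measurable (restrict_space borel ({0<..} \<times> I \<times> I)) \<and>
     (\<forall>t>0. \<forall>x\<in>I. \<forall>y\<in>I. 0 \<le> p t x y) \<and>
     (\<forall>t>0. \<forall>x\<in>I. \<forall>B\<in>sets borel. B \<subseteq> I \<longrightarrow>
        emeasure (P x) {\<omega> \<in> space (P x). X t \<omega> \<in> B} = (\<integral>\<^sup>+y\<in>B. ennreal (p t x y) \<partial>m))"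

definition green_kernel :: "(real \<Rightarrow> real \<Rightarrow> real \<Rightarrow> real) \<Rightarrow> real \<Rightarrow> real \<Rightarrow> real \<Rightarrow> real" where
  "green_kernel p lam x y = (LBINT t:{0<..}. exp (- lam * t) * p t x y)"

definition occupation_time :: "(real \<Rightarrow> 'w \<Rightarrow> real) \<Rightarrow> real \<Rightarrow> 'w \<Rightarrow> real" where
  "occupation_time X t \<omega> = measure lborel {s \<in> {0..t}. 0 \<le> X s \<omega>}"

definition occupation_moment ::
  "(real \<Rightarrow> 'w measure) \<Rightarrow> (real \<Rightarrow> 'w \<Rightarrow> real) \<Rightarrow> real \<Rightarrow> nat \<Rightarrow> real" where
  "occupation_moment P X t n = (\<integral>\<omega>. occupation_time X t \<omega> ^ n \<partial>P 0)"

definition occupation_moment_laplace ::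
  "(real \<Rightarrow> 'w measure) \<Rightarrow> (real \<Rightarrow> 'w \<Rightarrow> real) \<Rightarrow> real \<Rightarrow> nat \<Rightarrow> real" where
  "occupation_moment_laplace P X lam n =
     (LBINT t:{0..}. exp (- lam * t) * occupation_moment P X t n)"

definition hitting_laplace ::
  "(real \<Rightarrow> 'w measure) \<Rightarrow> (real \<Rightarrow> 'w \<Rightarrow> real) \<Rightarrow> real \<Rightarrow> real \<Rightarrow> real" where
  "hitting_laplace P X y lam =
     (\<integral>\<omega>. (if hitting_time X 0 \<omega> = \<infinity> then 0 else exp (- lam * enn2real (hitting_time X 0 \<omega>))) \<partial>P y)"

definition D_coeff ::
  "real set \<Rightarrow> (real \<Rightarrow> 'w measure) \<Rightarrow> (real \<Rightarrow> 'w \<Rightarrow> real) \<Rightarrow> real measure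
     \<Rightarrow> (real \<Rightarrow> real \<Rightarrow> real \<Rightarrow> real) \<Rightarrow> nat \<Rightarrow> real \<Rightarrow> real" where
  "D_coeff I P X m p k lam =
     (- lam) ^ k / fact (k - 1) *
     (LINT y:I \<inter> {0..}|m. green_kernel p lam 0 y * (deriv ^^ (k - 1)) (hitting_laplace P X y) lam)"

text \<open>Equality in distribution of processes is equality of the laws on the product space.\<close>

definition scaling_property :: "(real \<Rightarrow> 'w measure) \<Rightarrow> (real \<Rightarrow> 'w \<Rightarrow> real) \<Rightarrow> bool" where
  "scaling_property P X \<longleftrightarrow>
     (\<forall>a\<ge>0. \<exists>b\<ge>0.
        distr (P 0) path_space (\<lambda>\<omega>. \<lambda>t\<in>{0..}. X (a * t) \<omega>)
          = distr (P 0) path_space (\<lambda>\<omega>. \<lambda>t\<in>{0..}. b * X t \<omega>))"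

end

theory Submission
  imports Defs
begin

text \<open>
  Write \<open>A\<^sub>t(w)\<close> for the time that a path \<open>w\<close> spends in \<open>[0,\<infinity>)\<close> up to time \<open>t\<close>, and
  \<open>\<Psi>\<^sub>n(w) = \<integral>\<^sub>0\<^sup>\<infinity> e\<^sup>-\<^sup>\<lambda>\<^sup>t A\<^sub>t(w)\<^sup>n dt\<close> for its transform. The theorem follows from two identities that
  hold for each single path.

  First, \<open>dA\<^sub>s = 1{w\<^sub>s \<ge> 0} ds\<close> gives \<open>A\<^sub>t\<^sup>n\<^sup>+\<^sup>1 = (n+1) \<integral>\<^sub>0\<^sup>t 1{w\<^sub>s \<ge> 0} (A\<^sub>t - A\<^sub>s)\<^sup>n ds\<close>, where \<open>A\<^sub>t - A\<^sub>s\<close>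
  is the occupation time of the path restarted at \<open>s\<close>. Its transform is \<open>occ_laplace_Suc\<close>. The
  Markov property at fixed times and the transition density then yield \<open>mean_occ_laplace_Suc\<close>:
  \<open>E\<^sub>0 \<Psi>\<^sub>n\<^sub>+\<^sub>1 = (n+1) \<integral> G\<^sub>\<lambda>(0,y) E\<^sub>y \<Psi>\<^sub>n m(dy)\<close>, the integral being over \<open>y \<ge> 0\<close> in \<open>I\<close>.

  Secondly, a continuous path that starts at \<open>y \<ge> 0\<close> stays in \<open>[0,\<infinity>)\<close> until it hits \<open>0\<close> at time \<open>H\<close>,
  so \<open>A\<^sub>t = t\<close> up to \<open>H\<close>, and after \<open>H\<close> it is \<open>H\<close> plus the occupation time of the path restarted at \<open>H\<close>.
  Expanding the power by the binomial theorem, and treating \<open>t\<^sup>n\<close> in the same way, gives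
  \<open>occ_laplace_passage\<close>. The strong Markov property at \<open>H\<close> turns it into \<open>mean_occ_laplace_passage\<close>,
  which expresses \<open>E\<^sub>y \<Psi>\<^sub>n\<close> by the numbers \<open>E\<^sub>0 \<Psi>\<^sub>j\<close> with \<open>j \<le> n\<close> and the moments \<open>E\<^sub>y(e\<^sup>-\<^sup>\<lambda>\<^sup>H H\<^sup>k)\<close>. Up to the sign
  \<open>(-1)\<^sup>k\<close> the latter are the derivatives of the hitting transform in \<open>\<lambda>\<close>
  (\<open>higher_deriv_hitting_laplace\<close>).

  Inserting the second identity into the first gives the recursion. The term with \<open>j = 0\<close> drops
  out because \<open>E\<^sub>0 \<Psi>\<^sub>0 = 1/\<lambda>\<close>. Under the scaling property \<open>A\<^sub>t\<close> has the law of \<open>t A\<^sub>1\<close>, so that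
  \<open>E\<^sub>0 \<Psi>\<^sub>n = n! \<lambda>\<^sup>-\<^sup>n\<^sup>-\<^sup>1 E\<^sub>0 A\<^sub>1\<^sup>n\<close>, and the recursion becomes one for the moments of \<open>A\<^sub>1\<close>.

  All identities are proved with values in \<open>[0,\<infinity>]\<close>, with negative terms moved to the other side;
  this makes Fubini's theorem and the linearity of the integral available without integrability
  conditions. Finiteness matters only for the derivatives in \<open>\<lambda>\<close> and for the transfer of the recursion
  to the reals.
\<close>

section \<open>Powers of a tail integral\<close>

text \<open>The integrand is the density of the Erlang distribution up to its normalization.\<close>
lemma nn_integral_power_exp_Ici:
  assumes "0 < l"
  shows "(\<integral>\<^sup>+t. ennreal (t ^ n * exp (- l * t)) * indicator {0..} t \<partial>lborel)
    = ennreal (fact n / l ^ (n + 1))"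
proof -
  have "(\<integral>\<^sup>+t. ennreal (t ^ n * exp (- l * t)) * indicator {0..} t \<partial>lborel)
    = (\<integral>\<^sup>+t. ennreal (fact n / l ^ (n + 1)) * ennreal (erlang_density n l t) \<partial>lborel)"
    using assms by (intro nn_integral_cong)
      (auto simp: erlang_density_def ennreal_mult'[symmetric] split: split_indicator)
  also have "\<dots> = ennreal (fact n / l ^ (n + 1)) * (\<integral>\<^sup>+t. ennreal (erlang_density n l t) \<partial>lborel)"
    by (rule nn_integral_cmult) simp
  also have "(\<integral>\<^sup>+t. ennreal (erlang_density n l t) \<partial>lborel) = 1"
    using nn_integral_erlang_ith_moment[OF assms, of n 0] by simp
  finally show ?thesis by simp
qed

lemma nn_integral_shift:
  fixes f :: "real \<Rightarrow> ennreal"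
  assumes "f \<in> borel_measurable borel"
  shows "(\<integral>\<^sup>+t. f (c + t) \<partial>lborel) = (\<integral>\<^sup>+t. f t \<partial>lborel)"
  using nn_integral_real_affine[OF assms, of 1 c] by simp

text \<open>
  This is \<open>d(N\<^sup>n\<^sup>+\<^sup>1) = -(n+1) N\<^sup>n g du\<close> in integrated form. As \<open>g\<close> is only measurable, \<open>N\<close> need not be
  differentiable, and the proof goes by induction instead. Let \<open>K\<close> be the integral of \<open>g N\<^sup>n\<^sup>+\<^sup>1\<close>. By the
  induction hypothesis and Fubini's theorem, \<open>K\<close> is \<open>n+1\<close> times the integral of
  \<open>g(v) N(v)\<^sup>n \<integral>\<^sub>s\<^sup>v g\<close>. Adding \<open>(n+1) K\<close> completes \<open>\<integral>\<^sub>s\<^sup>v g\<close> to \<open>N(s)\<close>, so \<open>(n+2) K = N(s)\<^sup>n\<^sup>+\<^sup>2\<close>.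
\<close>
lemma nn_integral_tail_power:
  fixes g :: "real \<Rightarrow> ennreal"
  assumes g[measurable]: "g \<in> borel_measurable borel"
  defines "N \<equiv> \<lambda>s. \<integral>\<^sup>+v. g v * indicator {s..} v \<partial>lborel"
  shows "of_nat (Suc n) * (\<integral>\<^sup>+u. g u * N u ^ n * indicator {s..} u \<partial>lborel) = N s ^ Suc n"
proof (induction n arbitrary: s)
  case 0
  show ?case by (simp add: N_def)
next
  case (Suc n)
  have "N = (\<lambda>s. \<integral>\<^sup>+v. g v * indicator {0..} (v - s) \<partial>lborel)"
    unfolding N_def by (simp add: indicator_def)
  then have [measurable]: "N \<in> borel_measurable borel"
    by simp
  let ?K = "\<integral>\<^sup>+u. g u * N u ^ Suc n * indicator {s..} u \<partial>lborel"
  \<comment> \<open>The two intervals overlap in the null set consisting of \<open>v\<close>.\<close>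
  have split: "(\<integral>\<^sup>+u. g u * indicator {s..v} u \<partial>lborel) + N v = N s" if "s \<le> v" for v
  proof -
    have "(\<integral>\<^sup>+u. g u * indicator {s..v} u \<partial>lborel) + N v
      = (\<integral>\<^sup>+u. g u * indicator {s..v} u + g u * indicator {v..} u \<partial>lborel)"
      unfolding N_def by (rule nn_integral_add[symmetric]) auto
    also have "\<dots> = N s"
      unfolding N_def
    proof (rule nn_integral_cong_AE)
      have "AE u in lborel. u \<noteq> v" by (rule AE_lborel_singleton)
      then show "AE u in lborel. g u * indicator {s..v} u + g u * indicator {v..} u = g u * indicator {s..} u"
        by eventually_elim (use that in \<open>auto split: split_indicator\<close>)
    qed
    finally show ?thesis .
  qed
  have "?K = (\<integral>\<^sup>+u. g u * (of_nat (Suc n) * (\<integral>\<^sup>+v. g v * N v ^ n * indicator {u..} v \<partial>lborel))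
                * indicator {s..} u \<partial>lborel)"
    by (simp only: Suc.IH)
  also have "\<dots> = (\<integral>\<^sup>+u. of_nat (Suc n) * (\<integral>\<^sup>+v. g u * indicator {s..} u * (g v * N v ^ n * indicator {0..} (v - u)) \<partial>lborel) \<partial>lborel)"
  proof (rule nn_integral_cong)
    fix u
    have "(\<integral>\<^sup>+v. g u * indicator {s..} u * (g v * N v ^ n * indicator {0..} (v - u)) \<partial>lborel)
      = g u * indicator {s..} u * (\<integral>\<^sup>+v. g v * N v ^ n * indicator {0..} (v - u) \<partial>lborel)"
      by (rule nn_integral_cmult) measurable
    also have "(\<integral>\<^sup>+v. g v * N v ^ n * indicator {0..} (v - u) \<partial>lborel)
      = (\<integral>\<^sup>+v. g v * N v ^ n * indicator {u..} v \<partial>lborel)"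
      by (intro nn_integral_cong) (simp add: indicator_def)
    finally show "g u * (of_nat (Suc n) * (\<integral>\<^sup>+v. g v * N v ^ n * indicator {u..} v \<partial>lborel)) * indicator {s..} u
      = of_nat (Suc n) * (\<integral>\<^sup>+v. g u * indicator {s..} u * (g v * N v ^ n * indicator {0..} (v - u)) \<partial>lborel)"
      by (simp only: mult_ac)
  qed
  also have "\<dots> = of_nat (Suc n) * (\<integral>\<^sup>+u. (\<integral>\<^sup>+v. g u * indicator {s..} u * (g v * N v ^ n * indicator {0..} (v - u)) \<partial>lborel) \<partial>lborel)"
    by (rule nn_integral_cmult) measurable
  also have "(\<integral>\<^sup>+u. (\<integral>\<^sup>+v. g u * indicator {s..} u * (g v * N v ^ n * indicator {0..} (v - u)) \<partial>lborel) \<partial>lborel)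
    = (\<integral>\<^sup>+v. (\<integral>\<^sup>+u. g u * indicator {s..} u * (g v * N v ^ n * indicator {0..} (v - u)) \<partial>lborel) \<partial>lborel)"
    by (rule lborel_pair.Fubini') (measurable)
  also have "\<dots> = (\<integral>\<^sup>+v. (\<integral>\<^sup>+u. (g v * N v ^ n * indicator {s..} v) * (g u * indicator {s..v} u) \<partial>lborel) \<partial>lborel)"
    by (intro nn_integral_cong) (auto split: split_indicator simp: mult_ac)
  also have "\<dots> = (\<integral>\<^sup>+v. g v * N v ^ n * indicator {s..} v * (\<integral>\<^sup>+u. g u * indicator {s..v} u \<partial>lborel) \<partial>lborel)"
    by (intro nn_integral_cong nn_integral_cmult) auto
  finally have K: "?K = of_nat (Suc n) * \<dots>" .
  let ?L = "\<integral>\<^sup>+v. g v * N v ^ n * indicator {s..} v * (\<integral>\<^sup>+u. g u * indicator {s..v} u \<partial>lborel) \<partial>lborel"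
  let ?R = "\<integral>\<^sup>+v. g v * N v ^ n * indicator {s..} v * N v \<partial>lborel"
  have KR: "?K = ?R"
    by (intro nn_integral_cong) (simp add: mult_ac)
  have "(\<lambda>v. \<integral>\<^sup>+u. g u * indicator {s..v} u \<partial>lborel)
      = (\<lambda>v. \<integral>\<^sup>+u. g u * indicator {s..} u * indicator {0..} (v - u) \<partial>lborel)"
    by (intro ext nn_integral_cong) (simp split: split_indicator)
  then have [measurable]: "(\<lambda>v. \<integral>\<^sup>+u. g u * indicator {s..v} u \<partial>lborel) \<in> borel_measurable borel"
    by simp
  have "?R + ?L = (\<integral>\<^sup>+v. g v * N v ^ n * indicator {s..} v * N v
          + g v * N v ^ n * indicator {s..} v * (\<integral>\<^sup>+u. g u * indicator {s..v} u \<partial>lborel) \<partial>lborel)"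
    by (rule nn_integral_add[symmetric]) measurable
  also have "\<dots> = (\<integral>\<^sup>+v. g v * N v ^ n * indicator {s..} v * N s \<partial>lborel)"
  proof (rule nn_integral_cong)
    fix v
    show "g v * N v ^ n * indicator {s..} v * N v
          + g v * N v ^ n * indicator {s..} v * (\<integral>\<^sup>+u. g u * indicator {s..v} u \<partial>lborel)
       = g v * N v ^ n * indicator {s..} v * N s"
      using split[of v] by (cases "s \<le> v") (auto simp: distrib_left[symmetric] add.commute)
  qed
  also have "\<dots> = (\<integral>\<^sup>+v. g v * N v ^ n * indicator {s..} v \<partial>lborel) * N s"
    by (rule nn_integral_multc) measurable
  finally have RL: "?R + ?L = (\<integral>\<^sup>+v. g v * N v ^ n * indicator {s..} v \<partial>lborel) * N s" .
  have "of_nat (Suc (Suc n)) * ?K = of_nat (Suc n) * ?K + ?K"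
    by (simp only: of_nat_Suc[of "Suc n"] distrib_right mult_1_left add.commute)
  also have "\<dots> = of_nat (Suc n) * ?R + of_nat (Suc n) * ?L"
    by (simp only: K[symmetric] KR[symmetric])
  also have "\<dots> = of_nat (Suc n) * ((\<integral>\<^sup>+v. g v * N v ^ n * indicator {s..} v \<partial>lborel) * N s)"
    by (simp only: distrib_left[symmetric] RL)
  also have "\<dots> = N s ^ Suc (Suc n)"
    using Suc.IH[of s] by (simp only: mult.assoc[symmetric] power_Suc2)
  finally show ?case .
qed

section \<open>Occupation times of a single path\<close>

definition occ :: "(real \<Rightarrow> real) \<Rightarrow> real \<Rightarrow> ennreal" where
  "occ w t = emeasure lborel {s \<in> {0..t}. 0 \<le> w s}"

text \<open>The function \<open>\<Psi>\<^sub>n\<close> of the introduction, for the parameter \<open>\<lambda> = l\<close>.\<close>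
definition occ_laplace :: "real \<Rightarrow> nat \<Rightarrow> (real \<Rightarrow> real) \<Rightarrow> ennreal" where
  "occ_laplace l n w = (\<integral>\<^sup>+t. ennreal (exp (- l * t)) * occ w t ^ n * indicator {0..} t \<partial>lborel)"

lemma occ_cong: "(\<And>s. 0 \<le> s \<Longrightarrow> v s = w s) \<Longrightarrow> occ v t = occ w t"
  unfolding occ_def by (rule arg_cong[where f = "emeasure lborel"]) auto

lemma occ_laplace_cong: "(\<And>s. 0 \<le> s \<Longrightarrow> v s = w s) \<Longrightarrow> occ_laplace l n v = occ_laplace l n w"
  unfolding occ_laplace_def by (simp add: occ_cong[of v w])

lemma occ_le: "occ w t \<le> ennreal t"
proof -
  have "occ w t \<le> emeasure lborel {0..t}"
    unfolding occ_def by (rule emeasure_mono) auto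
  also have "\<dots> \<le> ennreal t"
    by (cases "0 \<le> t") auto
  finally show ?thesis .
qed

lemma occ_laplace_le:
  assumes "0 < l"
  shows "occ_laplace l n w \<le> ennreal (fact n / l ^ (n + 1))"
proof -
  have "occ_laplace l n w \<le> (\<integral>\<^sup>+t. ennreal (t ^ n * exp (- l * t)) * indicator {0..} t \<partial>lborel)"
    unfolding occ_laplace_def
  proof (rule nn_integral_mono)
    fix t
    show "ennreal (exp (- l * t)) * occ w t ^ n * indicator {0..} t
      \<le> ennreal (t ^ n * exp (- l * t)) * indicator {0..} t"
      using power_mono[OF occ_le, of w t n]
      by (auto split: split_indicator simp: ennreal_mult ennreal_power mult.commute[of "t ^ n"] intro!: mult_left_mono)
  qed
  then show ?thesis using nn_integral_power_exp_Ici[OF assms] by simp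
qed

lemma occ_laplace_0:
  assumes "0 < l"
  shows "occ_laplace l 0 w = ennreal (1 / l)"
  using nn_integral_power_exp_Ici[OF assms, of 0] by (simp add: occ_laplace_def)

lemma occ_eq_nn_integral:
  assumes [measurable]: "w \<in> borel_measurable borel"
  shows "occ w t = (\<integral>\<^sup>+v. indicator {0..t} v * indicator {0..} (w v) \<partial>lborel)"
proof -
  have "occ w t = (\<integral>\<^sup>+v. indicator {s \<in> {0..t}. 0 \<le> w s} v \<partial>lborel)"
    unfolding occ_def by (rule nn_integral_indicator[symmetric]) measurable
  also have "\<dots> = (\<integral>\<^sup>+v. indicator {0..t} v * indicator {0..} (w v) \<partial>lborel)"
    by (intro nn_integral_cong) (auto split: split_indicator)
  finally show ?thesis .
qed

lemma occ_shift:
  assumes [measurable]: "w \<in> borel_measurable borel"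
  shows "occ (\<lambda>u. w (s + u)) (t - s) = (\<integral>\<^sup>+v. indicator {s..t} v * indicator {0..} (w v) \<partial>lborel)"
proof -
  have "occ (\<lambda>u. w (s + u)) (t - s)
      = (\<integral>\<^sup>+v. indicator {s..t} (s + v) * indicator {0..} (w (s + v)) \<partial>lborel)"
    by (subst occ_eq_nn_integral) (auto intro!: nn_integral_cong split: split_indicator)
  also have "\<dots> = (\<integral>\<^sup>+v. indicator {s..t} v * indicator {0..} (w v) \<partial>lborel)"
    by (rule nn_integral_shift) measurable
  finally show ?thesis .
qed

lemma occ_add_shift:
  assumes [measurable]: "w \<in> borel_measurable borel" and "0 \<le> s" "s \<le> t"
  shows "occ w t = occ w s + occ (\<lambda>u. w (s + u)) (t - s)"
proof -
  have "occ w t = (\<integral>\<^sup>+v. indicator {0..s} v * indicator {0..} (w v)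
      + indicator {s..t} v * indicator {0..} (w v) \<partial>lborel)"
    unfolding occ_eq_nn_integral[OF assms(1)]
  proof (rule nn_integral_cong_AE)
    have "AE u in lborel. u \<noteq> s" by (rule AE_lborel_singleton)
    then show "AE v in lborel. (indicator {0..t} v * indicator {0..} (w v) :: ennreal) =
        indicator {0..s} v * indicator {0..} (w v) + indicator {s..t} v * indicator {0..} (w v)"
      by eventually_elim (use assms in \<open>auto split: split_indicator\<close>)
  qed
  also have "\<dots> = occ w s + occ (\<lambda>u. w (s + u)) (t - s)"
    unfolding occ_shift[OF assms(1)] occ_eq_nn_integral[OF assms(1)]
    by (rule nn_integral_add) measurable
  finally show ?thesis .
qed

text \<open>
  \<open>nn_integral_tail_power\<close> for the density \<open>1{0 \<le> s \<le> t, w\<^sub>s \<ge> 0}\<close>, whose tail from \<open>s\<close> is the occupation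
  time of the path restarted at \<open>s\<close>.
\<close>
lemma occ_power_Suc:
  assumes [measurable]: "w \<in> borel_measurable borel"
  shows "occ w t ^ Suc n = of_nat (Suc n) *
    (\<integral>\<^sup>+s. indicator {0..t} s * indicator {0..} (w s) * occ (\<lambda>u. w (s + u)) (t - s) ^ n \<partial>lborel)"
proof -
  let ?g = "\<lambda>v. indicator {0..t} v * indicator {0..} (w v) :: ennreal"
  have *: "(\<integral>\<^sup>+v. ?g v * indicator {s..} v \<partial>lborel) = occ (\<lambda>u. w (s + u)) (t - s)" if "0 \<le> s" for s
    unfolding occ_shift[OF assms] using that by (auto intro!: nn_integral_cong split: split_indicator)
  have "(\<integral>\<^sup>+v. ?g v * indicator {0..} v \<partial>lborel) = occ w t"
    using *[of 0] by simp
  then have "occ w t ^ Suc n = of_nat (Suc n) * (\<integral>\<^sup>+u. ?g u * (\<integral>\<^sup>+v. ?g v * indicator {u..} v \<partial>lborel) ^ n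
      * indicator {0..} u \<partial>lborel)"
    using nn_integral_tail_power[of ?g n 0] by (simp del: power_Suc of_nat_Suc)
  also have "\<dots> = of_nat (Suc n) *
    (\<integral>\<^sup>+s. indicator {0..t} s * indicator {0..} (w s) * occ (\<lambda>u. w (s + u)) (t - s) ^ n \<partial>lborel)"
    by (intro arg_cong[where f = "\<lambda>x. of_nat (Suc n) * x"] nn_integral_cong)
       (auto simp: * split: split_indicator)
  finally show ?thesis .
qed

lemma occ_measurable2:
  assumes [measurable]: "w \<in> borel_measurable borel"
  shows "(\<lambda>(s, t). occ (\<lambda>u. w (s + u)) (t - s)) \<in> borel_measurable (borel \<Otimes>\<^sub>M borel)"
proof -
  have "(\<lambda>(s, t). \<integral>\<^sup>+v. indicator {0..} (v - s) * indicator {0..} (t - v) * indicator {0..} (w v) \<partial>lborel)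
      \<in> borel_measurable (borel \<Otimes>\<^sub>M (borel :: real measure))"
    by measurable
  also have "(\<lambda>(s, t). \<integral>\<^sup>+v. indicator {0..} (v - s) * indicator {0..} (t - v) * indicator {0..} (w v) \<partial>lborel)
     = (\<lambda>(s, t). occ (\<lambda>u. w (s + u)) (t - s) :: ennreal)"
    unfolding occ_shift[OF assms] by (intro ext) (auto intro!: nn_integral_cong split: split_indicator)
  finally show ?thesis .
qed

text \<open>
  Transform \<open>occ_power_Suc\<close>, exchange the integrals over \<open>s \<le> t\<close> and substitute \<open>t = s + r\<close>;
  the factor \<open>e\<^sup>-\<^sup>\<lambda>\<^sup>s\<close> comes from the splitting \<open>e\<^sup>-\<^sup>\<lambda>\<^sup>t = e\<^sup>-\<^sup>\<lambda>\<^sup>s e\<^sup>-\<^sup>\<lambda>\<^sup>r\<close>.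
\<close>
lemma occ_laplace_Suc:
  assumes [measurable]: "w \<in> borel_measurable borel"
  shows "occ_laplace l (Suc n) w = of_nat (Suc n) *
    (\<integral>\<^sup>+s. ennreal (exp (- l * s)) * indicator {0..} s * indicator {0..} (w s) * occ_laplace l n (\<lambda>u. w (s + u)) \<partial>lborel)"
proof -
  let ?a = "\<lambda>s t. occ (\<lambda>u. w (s + u)) (t - s)"
  note [measurable] = occ_measurable2[OF assms, unfolded split_beta']
  have [measurable]: "(\<lambda>x. ?a (fst x) (snd x)) \<in> borel_measurable (lborel \<Otimes>\<^sub>M lborel)"
     "(\<lambda>x. ?a (snd x) (fst x)) \<in> borel_measurable (lborel \<Otimes>\<^sub>M lborel)"
    "\<And>s. (\<lambda>t. ?a s t) \<in> borel_measurable borel"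
    "\<And>t. (\<lambda>s. ?a s t) \<in> borel_measurable borel"
    using measurable_compose[OF _ occ_measurable2[OF assms], of "\<lambda>x. (snd x, fst x)" "lborel \<Otimes>\<^sub>M lborel"]
      measurable_compose[OF _ occ_measurable2[OF assms], of "\<lambda>x. (fst x, snd x)" "lborel \<Otimes>\<^sub>M lborel"]
      measurable_compose[OF _ occ_measurable2[OF assms], of "\<lambda>t. (_, t)" borel]
      measurable_compose[OF _ occ_measurable2[OF assms], of "\<lambda>t. (t, _)" borel]
    by (simp_all add: split_beta')
  let ?h = "\<lambda>s t. ennreal (exp (- l * t)) * indicator {0..} s * indicator {0..} (w s)
      * indicator {0..} (t - s) * ?a s t ^ n"
  have "occ_laplace l (Suc n) w = (\<integral>\<^sup>+t. of_nat (Suc n) * (\<integral>\<^sup>+s. ?h s t \<partial>lborel) \<partial>lborel)"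
    unfolding occ_laplace_def
  proof (rule nn_integral_cong)
    fix t
    have "ennreal (exp (- l * t)) * occ w t ^ Suc n * indicator {0..} t
      = of_nat (Suc n) * (ennreal (exp (- l * t)) * indicator {0..} t *
        (\<integral>\<^sup>+s. indicator {0..t} s * indicator {0..} (w s) * ?a s t ^ n \<partial>lborel))"
      unfolding occ_power_Suc[OF assms] by (simp only: mult_ac)
    also have "(ennreal (exp (- l * t)) * indicator {0..} t *
        (\<integral>\<^sup>+s. indicator {0..t} s * indicator {0..} (w s) * ?a s t ^ n \<partial>lborel))
      = (\<integral>\<^sup>+s. ennreal (exp (- l * t)) * indicator {0..} t *
          (indicator {0..t} s * indicator {0..} (w s) * ?a s t ^ n) \<partial>lborel)"
      by (rule nn_integral_cmult[symmetric]) measurable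
    also have "\<dots> = (\<integral>\<^sup>+s. ?h s t \<partial>lborel)"
      by (intro nn_integral_cong) (auto split: split_indicator)
    finally show "ennreal (exp (- l * t)) * occ w t ^ Suc n * indicator {0..} t
      = of_nat (Suc n) * (\<integral>\<^sup>+s. ?h s t \<partial>lborel)" .
  qed
  also have "\<dots> = of_nat (Suc n) * (\<integral>\<^sup>+t. \<integral>\<^sup>+s. ?h s t \<partial>lborel \<partial>lborel)"
    by (rule nn_integral_cmult) measurable
  also have "(\<integral>\<^sup>+t. \<integral>\<^sup>+s. ?h s t \<partial>lborel \<partial>lborel) = (\<integral>\<^sup>+s. \<integral>\<^sup>+t. ?h s t \<partial>lborel \<partial>lborel)"
    by (rule lborel_pair.Fubini') measurable
  also have "\<dots> = (\<integral>\<^sup>+s. ennreal (exp (- l * s)) * indicator {0..} s * indicator {0..} (w s)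
      * occ_laplace l n (\<lambda>u. w (s + u)) \<partial>lborel)"
  proof (rule nn_integral_cong)
    fix s
    have "(\<integral>\<^sup>+t. ?h s t \<partial>lborel) = (\<integral>\<^sup>+t. ?h s (s + t) \<partial>lborel)"
      by (rule nn_integral_shift[symmetric]) measurable
    also have "\<dots> = (\<integral>\<^sup>+t. ennreal (exp (- l * s)) * indicator {0..} s * indicator {0..} (w s) *
        (ennreal (exp (- l * t)) * occ (\<lambda>u. w (s + u)) t ^ n * indicator {0..} t) \<partial>lborel)"
    proof (rule nn_integral_cong)
      fix t
      have e: "ennreal (exp (- l * (s + t))) = ennreal (exp (- l * s)) * ennreal (exp (- l * t))"
        by (simp add: ennreal_mult'[symmetric] mult_exp_exp algebra_simps)
      show "?h s (s + t) = ennreal (exp (- l * s)) * indicator {0..} s * indicator {0..} (w s) *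
        (ennreal (exp (- l * t)) * occ (\<lambda>u. w (s + u)) t ^ n * indicator {0..} t)"
        unfolding e add_diff_cancel_left' by (simp only: mult_ac)
    qed
    also have "\<dots> = ennreal (exp (- l * s)) * indicator {0..} s * indicator {0..} (w s)
      * occ_laplace l n (\<lambda>u. w (s + u))"
      unfolding occ_laplace_def using measurable_compose[of "\<lambda>t. s + t" borel borel "?a s" borel]
      by (intro nn_integral_cmult) simp
    finally show "(\<integral>\<^sup>+t. ?h s t \<partial>lborel) = \<dots>" .
  qed
  finally show ?thesis .
qed

text \<open>
  Stated for a general clock \<open>b\<close> since it is needed twice: for the occupation time itself, and for
  \<open>b t = t\<close>. The part before \<open>h\<close> is the same in both cases.
\<close>
lemma nn_integral_laplace_split:
  assumes [measurable]: "b \<in> borel_measurable borel" "c \<in> borel_measurable borel"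
    and "0 \<le> h"
    and before: "\<And>t. 0 \<le> t \<Longrightarrow> t < h \<Longrightarrow> b t = ennreal t"
    and after: "\<And>t. 0 \<le> t \<Longrightarrow> b (h + t) = ennreal h + c t"
  shows "(\<integral>\<^sup>+t. ennreal (exp (- l * t)) * b t ^ n * indicator {0..} t \<partial>lborel)
    = (\<integral>\<^sup>+t. ennreal (exp (- l * t)) * ennreal t ^ n * indicator {0..<h} t \<partial>lborel)
      + (\<Sum>j\<le>n. of_nat (n choose j) * ennreal (exp (- l * h) * h ^ (n - j))
          * (\<integral>\<^sup>+t. ennreal (exp (- l * t)) * c t ^ j * indicator {0..} t \<partial>lborel))"
proof -
  let ?f = "\<lambda>t. ennreal (exp (- l * t)) * b t ^ n"
  have "(\<integral>\<^sup>+t. ?f t * indicator {0..} t \<partial>lborel)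
    = (\<integral>\<^sup>+t. ennreal (exp (- l * t)) * ennreal t ^ n * indicator {0..<h} t + ?f t * indicator {h..} t \<partial>lborel)"
    using \<open>0 \<le> h\<close> by (intro nn_integral_cong) (auto split: split_indicator simp: before)
  also have "\<dots> = (\<integral>\<^sup>+t. ennreal (exp (- l * t)) * ennreal t ^ n * indicator {0..<h} t \<partial>lborel)
      + (\<integral>\<^sup>+t. ?f t * indicator {h..} t \<partial>lborel)"
    by (rule nn_integral_add) measurable
  also have "(\<integral>\<^sup>+t. ?f t * indicator {h..} t \<partial>lborel) = (\<integral>\<^sup>+t. ?f (h + t) * indicator {h..} (h + t) \<partial>lborel)"
    by (rule nn_integral_shift[symmetric]) measurable
  also have "\<dots> = (\<integral>\<^sup>+t. (\<Sum>j\<le>n. of_nat (n choose j) * ennreal (exp (- l * h) * h ^ (n - j))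
          * (ennreal (exp (- l * t)) * c t ^ j * indicator {0..} t)) \<partial>lborel)"
  proof (rule nn_integral_cong)
    fix t
    have e: "ennreal (exp (- l * (h + t))) = ennreal (exp (- l * h)) * ennreal (exp (- l * t))"
      by (simp add: ennreal_mult'[symmetric] mult_exp_exp algebra_simps)
    have p: "ennreal (exp (- l * h) * h ^ k) = ennreal (exp (- l * h)) * ennreal h ^ k" for k
      using \<open>0 \<le> h\<close> by (simp add: ennreal_mult' ennreal_power)
    show "?f (h + t) * indicator {h..} (h + t) = (\<Sum>j\<le>n. of_nat (n choose j) * ennreal (exp (- l * h) * h ^ (n - j))
          * (ennreal (exp (- l * t)) * c t ^ j * indicator {0..} t))"
    proof (cases "0 \<le> t")
      case True
      have "?f (h + t) = ennreal (exp (- l * h)) * ennreal (exp (- l * t)) * (c t + ennreal h) ^ n"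
        unfolding e after[OF True] by (simp add: add.commute)
      also have "\<dots> = (\<Sum>j\<le>n. of_nat (n choose j) * ennreal (exp (- l * h) * h ^ (n - j))
          * (ennreal (exp (- l * t)) * c t ^ j))"
        unfolding binomial_ring sum_distrib_left p by (intro sum.cong refl) (simp only: mult_ac)
      finally show ?thesis using True by simp
    qed simp
  qed
  also have "\<dots> = (\<Sum>j\<le>n. \<integral>\<^sup>+t. of_nat (n choose j) * ennreal (exp (- l * h) * h ^ (n - j))
          * (ennreal (exp (- l * t)) * c t ^ j * indicator {0..} t) \<partial>lborel)"
    by (rule nn_integral_sum) measurable
  also have "\<dots> = (\<Sum>j\<le>n. of_nat (n choose j) * ennreal (exp (- l * h) * h ^ (n - j))
          * (\<integral>\<^sup>+t. ennreal (exp (- l * t)) * c t ^ j * indicator {0..} t \<partial>lborel))"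
    by (intro sum.cong refl nn_integral_cmult) measurable
  finally show ?thesis .
qed

lemma occ_measurable [measurable]:
  assumes "w \<in> borel_measurable borel"
  shows "occ w \<in> borel_measurable borel"
  using measurable_compose[OF _ occ_measurable2[OF assms], of "\<lambda>t. (0, t)" borel] by simp

lemma occ_eq_time:
  assumes "\<And>s. 0 \<le> s \<Longrightarrow> s < t \<Longrightarrow> 0 \<le> w s" "0 \<le> t" and [measurable]: "w \<in> borel_measurable borel"
  shows "occ w t = ennreal t"
proof -
  have "ennreal t = emeasure lborel {0..<t}" using assms by simp
  also have "\<dots> \<le> occ w t"
    unfolding occ_def using assms by (intro emeasure_mono) auto
  finally show ?thesis using occ_le[of w t] by (rule antisym[rotated])
qed

text \<open>
  Subtracting the two instances of the splitting cancels the integral over \<open>[0,h)\<close>, which has no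
  simple closed form. The subtraction is written additively, with the terms of the clock \<open>t\<close> on the
  left.
\<close>
lemma occ_laplace_passage:
  assumes "0 < l" and w[measurable]: "w \<in> borel_measurable borel" and "0 \<le> h"
    and pos: "\<And>s. 0 \<le> s \<Longrightarrow> s < h \<Longrightarrow> 0 \<le> w s"
  shows "occ_laplace l n w + (\<Sum>j\<le>n. of_nat (n choose j) * ennreal (exp (- l * h) * h ^ (n - j)) * ennreal (fact j / l ^ (j + 1)))
    = ennreal (fact n / l ^ (n + 1))
      + (\<Sum>j\<le>n. of_nat (n choose j) * ennreal (exp (- l * h) * h ^ (n - j)) * occ_laplace l j (\<lambda>u. w (h + u)))"
proof -
  let ?B = "\<integral>\<^sup>+t. ennreal (exp (- l * t)) * ennreal t ^ n * indicator {0..<h} t \<partial>lborel"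
  have w': "(\<lambda>u. w (h + u)) \<in> borel_measurable borel" by simp
  have 1: "occ_laplace l n w = ?B + (\<Sum>j\<le>n. of_nat (n choose j) * ennreal (exp (- l * h) * h ^ (n - j)) * occ_laplace l j (\<lambda>u. w (h + u)))"
    unfolding occ_laplace_def
  proof (rule nn_integral_laplace_split[OF occ_measurable[OF w] occ_measurable[OF w'] \<open>0 \<le> h\<close>])
    show "occ w t = ennreal t" if "0 \<le> t" "t < h" for t
      using that pos by (intro occ_eq_time) auto
    show "occ w (h + t) = ennreal h + occ (\<lambda>u. w (h + u)) t" if "0 \<le> t" for t
      using occ_add_shift[OF w \<open>0 \<le> h\<close>, of "h + t"] occ_eq_time[of h w] that pos \<open>0 \<le> h\<close> by simp
  qed
  have gamma: "(\<integral>\<^sup>+t. ennreal (exp (- l * t)) * ennreal t ^ k * indicator {0..} t \<partial>lborel)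
    = ennreal (fact k / l ^ (k + 1))" for k
    unfolding nn_integral_power_exp_Ici[OF \<open>0 < l\<close>, of k, symmetric]
    by (intro nn_integral_cong) (auto split: split_indicator simp: ennreal_mult' ennreal_power mult.commute)
  have 2: "(\<integral>\<^sup>+t. ennreal (exp (- l * t)) * ennreal t ^ n * indicator {0..} t \<partial>lborel) =
    ?B + (\<Sum>j\<le>n. of_nat (n choose j) * ennreal (exp (- l * h) * h ^ (n - j)) *
     (\<integral>\<^sup>+t. ennreal (exp (- l * t)) * ennreal t ^ j * indicator {0..} t \<partial>lborel))"
    by (rule nn_integral_laplace_split) (use \<open>0 \<le> h\<close> in auto)
  show ?thesis
    unfolding 1 using 2 unfolding gamma by (simp add: ac_simps)
qed

section \<open>Measurability on path space\<close>

text \<open>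
  The product sigma-algebra sees a path at countably many times only, so that the occupation time
  is not measurable with respect to it. Reading the path at the times \<open>\<lfloor>s(N+1)\<rfloor>/(N+1)\<close> and
  letting \<open>N \<rightarrow> \<infinity>\<close> reproduces every continuous path on \<open>[0,\<infinity>)\<close> (\<open>grid_limit_eq\<close>), and the result is
  jointly measurable in path and time. Functionals of the path are therefore evaluated at its
  grid limit. Where the limit does not exist, \<open>lim\<close> is an arbitrary value.
\<close>
definition grid_limit :: "(real \<Rightarrow> real) \<Rightarrow> real \<Rightarrow> real" where
  "grid_limit w s = lim (\<lambda>N. w (real (nat \<lfloor>s * real (Suc N)\<rfloor>) / real (Suc N)))"

lemma grid_limit_eq:
  assumes "continuous_on {0..} w" "0 \<le> s"
  shows "grid_limit w s = w s"
  unfolding grid_limit_def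
proof (rule limI)
  let ?q = "\<lambda>N. real (nat \<lfloor>s * real (Suc N)\<rfloor>) / real (Suc N)"
  have "?q \<longlonglongrightarrow> s"
  proof (rule real_tendsto_sandwich)
    show "\<forall>\<^sub>F N in sequentially. s - 1 / real (Suc N) \<le> ?q N"
    proof (intro always_eventually allI)
      fix N
      have "s * real (Suc N) - 1 \<le> real (nat \<lfloor>s * real (Suc N)\<rfloor>)" by linarith
      then have "(s * real (Suc N) - 1) / real (Suc N) \<le> ?q N" by (rule divide_right_mono) simp
      then show "s - 1 / real (Suc N) \<le> ?q N" by (simp add: diff_divide_distrib)
    qed
    show "\<forall>\<^sub>F N in sequentially. ?q N \<le> s"
    proof (intro always_eventually allI)
      fix N
      have "0 \<le> s * real (Suc N)" using assms by simp
      then have "real (nat \<lfloor>s * real (Suc N)\<rfloor>) \<le> s * real (Suc N)" by linarith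
      then show "?q N \<le> s" by (simp add: pos_divide_le_eq)
    qed
    have "(\<lambda>N. s - 1 / real (Suc N)) \<longlonglongrightarrow> s - 0"
      using LIMSEQ_inverse_real_of_nat unfolding inverse_eq_divide by (intro tendsto_diff tendsto_const)
    then show "(\<lambda>N. s - 1 / real (Suc N)) \<longlonglongrightarrow> s" by simp
  qed simp
  then show "(\<lambda>N. w (?q N)) \<longlonglongrightarrow> w s"
    using assms by (intro continuous_on_tendsto_compose[OF assms(1)]) auto
qed

lemma grid_limit_restrict: "grid_limit (restrict w {0..}) = grid_limit w"
  by (intro ext) (simp add: grid_limit_def)

text \<open>
  The approximations take countably many grid times as arguments, hence are jointly measurable,
  and measurability passes to the limit.
\<close>
lemma measurable_grid_limit:
  fixes Y :: "real \<Rightarrow> 'a \<Rightarrow> real"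
  assumes [measurable]: "\<And>t. 0 \<le> t \<Longrightarrow> Y t \<in> borel_measurable N"
  shows "(\<lambda>x. grid_limit (\<lambda>t. Y t (fst x)) (snd x)) \<in> borel_measurable (N \<Otimes>\<^sub>M borel)"
  unfolding grid_limit_def
proof (rule borel_measurable_lim_metric)
  fix i
  let ?f = "\<lambda>k x. Y (real k / real (Suc i)) (fst x)"
  have "(\<lambda>x. ?f (nat \<lfloor>snd x * real (Suc i)\<rfloor>) x) \<in> borel_measurable (N \<Otimes>\<^sub>M borel)"
  proof (rule measurable_compose_countable[where f = ?f])
    show "?f k \<in> borel_measurable (N \<Otimes>\<^sub>M borel)" for k
      by (rule measurable_compose[OF measurable_fst]) (simp add: assms)
  qed measurable
  then show "(\<lambda>x. Y (real (nat \<lfloor>snd x * real (Suc i)\<rfloor>) / real (Suc i)) (fst x)) \<in> borel_measurable (N \<Otimes>\<^sub>M borel)" .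
qed

lemma grid_limit_borel [measurable]: "grid_limit w \<in> borel_measurable borel"
  using measurable_compose[OF _ measurable_grid_limit[of "\<lambda>t _. w t" "count_space UNIV"], of "\<lambda>s. ((), s)" borel]
  by simp

lemma measurable_occ_process:
  assumes Z[measurable]: "(\<lambda>x. Z (fst x) (snd x)) \<in> borel_measurable (N \<Otimes>\<^sub>M borel)"
  shows "(\<lambda>x. occ (Z (fst x)) (snd x)) \<in> borel_measurable (N \<Otimes>\<^sub>M borel)"
proof -
  have [measurable]: "(\<lambda>x. Z (fst (fst x)) (snd x)) \<in> borel_measurable ((N \<Otimes>\<^sub>M borel) \<Otimes>\<^sub>M borel)"
    using measurable_compose[OF _ Z, of "\<lambda>x. (fst (fst x), snd x)" "(N \<Otimes>\<^sub>M borel) \<Otimes>\<^sub>M borel"] by simp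
  have "(\<lambda>x. \<integral>\<^sup>+v. indicator {0..} v * indicator {0..} (snd x - v) * indicator {0..} (Z (fst x) v) \<partial>lborel)
     \<in> borel_measurable (N \<Otimes>\<^sub>M borel)"
    by measurable
  moreover have "occ (Z (fst x)) (snd x) =
     (\<integral>\<^sup>+v. indicator {0..} v * indicator {0..} (snd x - v) * indicator {0..} (Z (fst x) v) \<partial>lborel)"
    if "x \<in> space (N \<Otimes>\<^sub>M borel)" for x
  proof (subst occ_eq_nn_integral)
    show "Z (fst x) \<in> borel_measurable borel"
      using measurable_compose[OF _ Z, of "\<lambda>s. (fst x, s)" borel] that by (auto simp: space_pair_measure)
  qed (auto intro!: nn_integral_cong split: split_indicator)
  ultimately show ?thesis by (simp cong: measurable_cong)
qed

lemma measurable_occ_laplace_process: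
  assumes "(\<lambda>x. Z (fst x) (snd x)) \<in> borel_measurable (N \<Otimes>\<^sub>M borel)"
  shows "(\<lambda>x. occ_laplace l n (Z x)) \<in> borel_measurable N"
proof -
  note [measurable] = measurable_occ_process[OF assms]
  show ?thesis unfolding occ_laplace_def by measurable
qed

lemma measurable_occ_laplace_grid_limit: "(\<lambda>w. occ_laplace l n (grid_limit w)) \<in> borel_measurable path_space"
proof (rule measurable_occ_laplace_process[where Z = grid_limit])
  have "(\<lambda>x. grid_limit (\<lambda>t. (fst x) t) (snd x)) \<in> borel_measurable (path_space \<Otimes>\<^sub>M borel)"
    by (rule measurable_grid_limit) (simp add: path_space_def)
  then show "(\<lambda>x. grid_limit (fst x) (snd x)) \<in> borel_measurable (path_space \<Otimes>\<^sub>M borel)" by simp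
qed

section \<open>The strong Markov property for nonnegative functionals\<close>

context regular_diffusion
begin

lemma space_P: "x \<in> I \<Longrightarrow> space (P x) = space M"
  and sets_P: "x \<in> I \<Longrightarrow> sets (P x) = sets M"
  and prob_space_P: "x \<in> I \<Longrightarrow> prob_space (P x)"
  using measurable_space[OF kernel, of x]
  by (auto simp: space_restrict_space space_prob_algebra dest: sets_eq_imp_space_eq)

lemma measurable_P: "x \<in> I \<Longrightarrow> measurable (P x) N = measurable M N"
  using sets_P by (intro measurable_cong_sets) auto

lemma measurable_F_M: "f \<in> measurable (F t) N \<Longrightarrow> f \<in> measurable M N"
  using sub_sigma[of t] space_F[of t] by (auto simp: measurable_def)

lemma measurable_X: "0 \<le> t \<Longrightarrow> X t \<in> borel_measurable M"
  using adapted measurable_F_M by blast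

abbreviation traj :: "'w \<Rightarrow> real \<Rightarrow> real" where
  "traj \<omega> \<equiv> grid_limit (\<lambda>t. X t \<omega>)"

lemma traj_eq: "\<omega> \<in> space M \<Longrightarrow> 0 \<le> t \<Longrightarrow> traj \<omega> t = X t \<omega>"
  using continuous_paths by (rule grid_limit_eq)

lemma measurable_traj: "(\<lambda>x. traj (fst x) (snd x)) \<in> borel_measurable (M \<Otimes>\<^sub>M borel)"
  by (rule measurable_grid_limit) (rule measurable_X)

lemma measurable_X_random_time:
  assumes [measurable]: "\<tau> \<in> borel_measurable M" and "\<And>\<omega>. \<omega> \<in> space M \<Longrightarrow> 0 \<le> \<tau> \<omega>"
  shows "(\<lambda>\<omega>. X (\<tau> \<omega>) \<omega>) \<in> borel_measurable M"
proof -
  have "(\<lambda>\<omega>. traj \<omega> (\<tau> \<omega>)) \<in> borel_measurable M"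
    using measurable_compose[OF _ measurable_traj, of "\<lambda>\<omega>. (\<omega>, \<tau> \<omega>)" M] by simp
  then show ?thesis
    using assms(2) by (simp add: traj_eq cong: measurable_cong)
qed

lemma measurable_shifted_path:
  assumes [measurable]: "\<tau> \<in> borel_measurable M" and "\<And>\<omega>. \<omega> \<in> space M \<Longrightarrow> 0 \<le> \<tau> \<omega>"
  shows "(\<lambda>\<omega>. \<lambda>s\<in>{0..}. X (\<tau> \<omega> + s) \<omega>) \<in> M \<rightarrow>\<^sub>M path_space"
  unfolding path_space_def
  by (rule measurable_restrict) (use assms(2) in \<open>auto intro!: measurable_X_random_time add_nonneg_nonneg\<close>)

lemma grid_limit_shifted_path:
  assumes "\<omega> \<in> space M" "0 \<le> c" "0 \<le> s"
  shows "grid_limit (\<lambda>s\<in>{0..}. X (c + s) \<omega>) s = traj \<omega> (c + s)"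
proof -
  have "continuous_on {0..} (\<lambda>s. X (c + s) \<omega>)"
    using \<open>0 \<le> c\<close> by (intro continuous_on_compose2[OF continuous_paths[OF assms(1)]] continuous_intros) auto
  then show ?thesis
    unfolding grid_limit_restrict using assms by (simp add: grid_limit_eq traj_eq)
qed

lemma occ_laplace_shifted_path:
  assumes "\<omega> \<in> space M" "0 \<le> c"
  shows "occ_laplace l n (grid_limit (\<lambda>s\<in>{0..}. X (c + s) \<omega>)) = occ_laplace l n (\<lambda>s. traj \<omega> (c + s))"
  using grid_limit_shifted_path[OF assms] by (rule occ_laplace_cong)

definition expect_path :: "((real \<Rightarrow> real) \<Rightarrow> ennreal) \<Rightarrow> real \<Rightarrow> ennreal" where
  "expect_path g x = (\<integral>\<^sup>+\<omega>. g (\<lambda>s\<in>{0..}. X s \<omega>) \<partial>P x)"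

lemma measurable_nn_integral_kernel:
  assumes "f \<in> borel_measurable M"
  shows "(\<lambda>x. \<integral>\<^sup>+\<omega>. f \<omega> \<partial>P x) \<in> borel_measurable (restrict_space borel I)"
  using measurable_compose[OF measurable_prob_algebraD[OF kernel] nn_integral_measurable_subprob_algebra[OF assms]]
  by simp

lemma measurable_unshifted_path: "(\<lambda>\<omega>. \<lambda>s\<in>{0..}. X s \<omega>) \<in> M \<rightarrow>\<^sub>M path_space"
  using measurable_shifted_path[of "\<lambda>_. 0"] by simp

lemma measurable_expect_path:
  assumes "g \<in> borel_measurable path_space"
  shows "expect_path g \<in> borel_measurable (restrict_space borel I)"
  unfolding expect_path_def
  by (rule measurable_nn_integral_kernel) (rule measurable_compose[OF measurable_unshifted_path assms])

lemma stopping_time_measurable: "stopping_time F T \<Longrightarrow> T \<in> borel_measurable M"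
  by (rule measurable_stopping_time[OF _ sub_sigma space_F])

lemma pre_sigma_subset:
  assumes "stopping_time F T" "A \<in> sets (pre_sigma T)"
  shows "A \<in> sets M"
proof -
  have "{\<omega> \<in> A. T \<omega> \<le> top} \<in> sets (F top)"
    using assms by (rule sets_pre_sigmaD)
  then show ?thesis using sub_sigma by auto
qed

lemma measurable_pre_sigma_M:
  assumes "stopping_time F T" "f \<in> measurable (pre_sigma T) N"
  shows "f \<in> measurable M N"
proof (rule measurableI)
  show "f \<omega> \<in> space N" if "\<omega> \<in> space M" for \<omega>
    using measurable_space[OF assms(2)] that by (simp add: space_pre_sigma)
  show "f -` A \<inter> space M \<in> sets M" if "A \<in> sets N" for A
    using pre_sigma_subset[OF assms(1) measurable_sets[OF assms(2) that]] by (simp add: space_pre_sigma)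
qed

text \<open>
  The strong Markov property is given for indicators of events; it extends by linearity and
  monotone convergence, first in the functional \<open>g\<close> of the future path and then in the
  variable \<open>u\<close> that is known at time \<open>T\<close>.
\<close>
lemma strong_Markov_nn_integral:
  assumes x: "x \<in> I" and T: "stopping_time F T"
    and u: "u \<in> borel_measurable (pre_sigma T)" and g: "g \<in> borel_measurable path_space"
  shows "(\<integral>\<^sup>+\<omega>. u \<omega> * g (\<lambda>s\<in>{0..}. X (enn2real (T \<omega>) + s) \<omega>) * indicator {\<omega>. T \<omega> < \<infinity>} \<omega> \<partial>P x)
    = (\<integral>\<^sup>+\<omega>. u \<omega> * expect_path g (X (enn2real (T \<omega>)) \<omega>) * indicator {\<omega>. T \<omega> < \<infinity>} \<omega> \<partial>P x)"
proof -
  note [simp] = measurable_P[OF x] space_P[OF x] sets_P[OF x]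
  have T_M[measurable]: "T \<in> borel_measurable M" using T by (rule stopping_time_measurable)
  let ?s = "\<lambda>\<omega>. \<lambda>s\<in>{0..}. X (enn2real (T \<omega>) + s) \<omega>"
  have s[measurable]: "?s \<in> M \<rightarrow>\<^sub>M path_space"
    by (rule measurable_shifted_path) auto
  have XT: "(\<lambda>\<omega>. X (enn2real (T \<omega>)) \<omega>) \<in> M \<rightarrow>\<^sub>M restrict_space borel I"
    by (rule measurable_restrict_space2) (auto intro!: conservative measurable_X_random_time)
  have E: "(\<lambda>\<omega>. expect_path h (X (enn2real (T \<omega>)) \<omega>)) \<in> borel_measurable M"
    if "h \<in> borel_measurable path_space" for h
    by (rule measurable_compose[OF XT measurable_expect_path[OF that]])
  have p: "(\<lambda>\<omega>. h (\<lambda>s\<in>{0..}. X s \<omega>)) \<in> borel_measurable (P y)"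
    if "h \<in> borel_measurable path_space" "y \<in> I" for h y
    unfolding measurable_P[OF that(2)] by (rule measurable_compose[OF measurable_unshifted_path that(1)])
  have expect_cmult: "expect_path (\<lambda>w. c * h w) y = c * expect_path h y"
    if "h \<in> borel_measurable path_space" "y \<in> I" for c h y
    unfolding expect_path_def by (rule nn_integral_cmult[OF p[OF that]])
  have expect_add: "expect_path (\<lambda>w. k w + h w) y = expect_path k y + expect_path h y"
    if "h \<in> borel_measurable path_space" "y \<in> I" "k \<in> borel_measurable path_space" for h k y
    unfolding expect_path_def by (rule nn_integral_add[OF p[OF that(3,2)] p[OF that(1,2)]])
  let ?J = "indicator {\<omega>. T \<omega> < \<infinity>} :: 'w \<Rightarrow> ennreal"
  have J[measurable]: "?J \<in> borel_measurable M" by measurable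
  have indicator_case: "(\<integral>\<^sup>+\<omega>. indicator A \<omega> * h (?s \<omega>) * ?J \<omega> \<partial>P x)
      = (\<integral>\<^sup>+\<omega>. indicator A \<omega> * expect_path h (X (enn2real (T \<omega>)) \<omega>) * ?J \<omega> \<partial>P x)"
    if h: "h \<in> borel_measurable path_space" and A: "A \<in> sets (pre_sigma T)" for h A
    using h
  proof (induction h rule: borel_measurable_induct)
    case (cong f g)
    have "expect_path f = expect_path g"
      unfolding expect_path_def
      by (intro ext arg_cong2[where f = nn_integral] refl)
         (use cong in \<open>simp add: path_space_def space_PiM PiE_def\<close>)
    moreover have "f (?s \<omega>) = g (?s \<omega>)" if "\<omega> \<in> space M" for \<omega>
      using cong(3)[OF measurable_space[OF s that]] .
    then have "(\<integral>\<^sup>+\<omega>. indicator A \<omega> * f (?s \<omega>) * ?J \<omega> \<partial>P x) = (\<integral>\<^sup>+\<omega>. indicator A \<omega> * g (?s \<omega>) * ?J \<omega> \<partial>P x)"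
      by (intro nn_integral_cong) simp
    ultimately show ?case
      using cong(4) by (simp only:)
  next
    case (set B)
    have A_M[measurable]: "A \<in> sets M" by (rule pre_sigma_subset[OF T A])
    have expect_ind: "expect_path (indicator B) y = emeasure (P y) {\<omega>' \<in> space M. (\<lambda>s\<in>{0..}. X s \<omega>') \<in> B}"
      if "y \<in> I" for y
    proof -
      have "{\<omega>' \<in> space M. (\<lambda>s\<in>{0..}. X s \<omega>') \<in> B} \<in> sets (P y)"
        using measurable_sets[OF measurable_unshifted_path set] sets_P[OF that] by (simp add: vimage_def Int_def conj_commute)
      then have "emeasure (P y) {\<omega>' \<in> space M. (\<lambda>s\<in>{0..}. X s \<omega>') \<in> B}
        = (\<integral>\<^sup>+\<omega>. indicator {\<omega>' \<in> space M. (\<lambda>s\<in>{0..}. X s \<omega>') \<in> B} \<omega> \<partial>P y)"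
        by (rule nn_integral_indicator[symmetric])
      also have "\<dots> = expect_path (indicator B) y"
        unfolding expect_path_def using space_P[OF that]
        by (intro nn_integral_cong) (auto split: split_indicator)
      finally show ?thesis by simp
    qed
    have [measurable]: "B \<in> sets path_space" by fact
    have "{\<omega> \<in> A. T \<omega> < \<infinity> \<and> ?s \<omega> \<in> B} = A \<inter> {\<omega> \<in> space M. T \<omega> < \<infinity> \<and> ?s \<omega> \<in> B}"
      using sets.sets_into_space[OF A_M] by auto
    also have "\<dots> \<in> sets M" by measurable
    finally have AB: "{\<omega> \<in> A. T \<omega> < \<infinity> \<and> ?s \<omega> \<in> B} \<in> sets (P x)" by simp
    have "(\<integral>\<^sup>+\<omega>. indicator A \<omega> * indicator B (?s \<omega>) * ?J \<omega> \<partial>P x)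
      = (\<integral>\<^sup>+\<omega>. indicator {\<omega> \<in> A. T \<omega> < \<infinity> \<and> ?s \<omega> \<in> B} \<omega> \<partial>P x)"
      by (intro nn_integral_cong) (auto split: split_indicator)
    also have "\<dots> = emeasure (P x) {\<omega> \<in> A. T \<omega> < \<infinity> \<and> ?s \<omega> \<in> B}"
      by (rule nn_integral_indicator[OF AB])
    also have "\<dots> = (\<integral>\<^sup>+\<omega>\<in>{\<omega> \<in> A. T \<omega> < \<infinity>}.
               emeasure (P (X (enn2real (T \<omega>)) \<omega>)) {\<omega>' \<in> space M. (\<lambda>s\<in>{0..}. X s \<omega>') \<in> B} \<partial>P x)"
      by (rule strong_Markov[OF x T A set])
    also have "\<dots> = (\<integral>\<^sup>+\<omega>. indicator A \<omega> * expect_path (indicator B) (X (enn2real (T \<omega>)) \<omega>) * ?J \<omega> \<partial>P x)"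
      by (intro nn_integral_cong) (auto split: split_indicator simp: expect_ind conservative)
    finally show ?case .
  next
    case (mult h c)
    have [measurable]: "A \<in> sets M" by (rule pre_sigma_subset[OF T A])
    note [measurable] = mult.hyps E[OF mult.hyps(2)]
    have "(\<integral>\<^sup>+\<omega>. indicator A \<omega> * (c * h (?s \<omega>)) * ?J \<omega> \<partial>P x)
      = (\<integral>\<^sup>+\<omega>. c * (indicator A \<omega> * h (?s \<omega>) * ?J \<omega>) \<partial>P x)"
      by (simp only: mult_ac)
    also have "\<dots> = c * (\<integral>\<^sup>+\<omega>. indicator A \<omega> * h (?s \<omega>) * ?J \<omega> \<partial>P x)"
      by (rule nn_integral_cmult) simp
    also have "\<dots> = (\<integral>\<^sup>+\<omega>. c * (indicator A \<omega> * expect_path h (X (enn2real (T \<omega>)) \<omega>) * ?J \<omega>) \<partial>P x)"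
      unfolding mult.IH by (rule nn_integral_cmult[symmetric]) simp
    also have "\<dots> = (\<integral>\<^sup>+\<omega>. indicator A \<omega> * expect_path (\<lambda>w. c * h w) (X (enn2real (T \<omega>)) \<omega>) * ?J \<omega> \<partial>P x)"
      by (intro nn_integral_cong) (simp add: expect_cmult[OF mult.hyps(2)] conservative mult_ac)
    finally show ?case .
  next
    case (add h k)
    have [measurable]: "A \<in> sets M" by (rule pre_sigma_subset[OF T A])
    note [measurable] = add.hyps E[OF add.hyps(1)] E[OF add.hyps(3)]
    have "(\<integral>\<^sup>+\<omega>. indicator A \<omega> * (k (?s \<omega>) + h (?s \<omega>)) * ?J \<omega> \<partial>P x)
      = (\<integral>\<^sup>+\<omega>. indicator A \<omega> * k (?s \<omega>) * ?J \<omega> + indicator A \<omega> * h (?s \<omega>) * ?J \<omega> \<partial>P x)"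
      by (simp only: distrib_left distrib_right)
    also have "\<dots> = (\<integral>\<^sup>+\<omega>. indicator A \<omega> * k (?s \<omega>) * ?J \<omega> \<partial>P x) + (\<integral>\<^sup>+\<omega>. indicator A \<omega> * h (?s \<omega>) * ?J \<omega> \<partial>P x)"
      by (rule nn_integral_add) simp_all
    also have "\<dots> = (\<integral>\<^sup>+\<omega>. indicator A \<omega> * expect_path k (X (enn2real (T \<omega>)) \<omega>) * ?J \<omega>
        + indicator A \<omega> * expect_path h (X (enn2real (T \<omega>)) \<omega>) * ?J \<omega> \<partial>P x)"
      unfolding add.IH by (rule nn_integral_add[symmetric]) simp_all
    also have "\<dots> = (\<integral>\<^sup>+\<omega>. indicator A \<omega> * expect_path (\<lambda>w. k w + h w) (X (enn2real (T \<omega>)) \<omega>) * ?J \<omega> \<partial>P x)"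
      by (intro nn_integral_cong) (simp add: expect_add[OF add.hyps(1) _ add.hyps(3)] conservative distrib_left distrib_right)
    finally show ?case .
  next
    case (seq U)
    have [measurable]: "A \<in> sets M" by (rule pre_sigma_subset[OF T A])
    note [measurable] = seq.hyps(1) E[OF seq.hyps(1)]
    have expect_SUP: "expect_path (SUP i. U i) y = (SUP i. expect_path (U i) y)" if "y \<in> I" for y
      unfolding expect_path_def SUP_apply
      using seq.hyps(3) seq.hyps(1)[THEN measurable_compose[OF measurable_unshifted_path]]
      by (intro nn_integral_monotone_convergence_SUP)
         (auto simp: incseq_def le_fun_def measurable_P[OF that])
    have expect_mono: "expect_path (U i) y \<le> expect_path (U j) y" if "i \<le> j" for i j y
      unfolding expect_path_def using seq.hyps(3) that by (intro nn_integral_mono) (auto simp: incseq_def le_fun_def)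
    have "(\<integral>\<^sup>+\<omega>. indicator A \<omega> * (SUP i. U i) (?s \<omega>) * ?J \<omega> \<partial>P x)
      = (\<integral>\<^sup>+\<omega>. (SUP i. indicator A \<omega> * U i (?s \<omega>) * ?J \<omega>) \<partial>P x)"
      unfolding SUP_apply SUP_mult_left_ennreal SUP_mult_right_ennreal ..
    also have "\<dots> = (SUP i. \<integral>\<^sup>+\<omega>. indicator A \<omega> * U i (?s \<omega>) * ?J \<omega> \<partial>P x)"
      using seq.hyps(3)
      by (intro nn_integral_monotone_convergence_SUP) (auto simp: incseq_def le_fun_def intro!: mult_mono)
    also have "\<dots> = (SUP i. \<integral>\<^sup>+\<omega>. indicator A \<omega> * expect_path (U i) (X (enn2real (T \<omega>)) \<omega>) * ?J \<omega> \<partial>P x)"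
      by (simp only: seq.IH)
    also have "\<dots> = (\<integral>\<^sup>+\<omega>. (SUP i. indicator A \<omega> * expect_path (U i) (X (enn2real (T \<omega>)) \<omega>) * ?J \<omega>) \<partial>P x)"
      by (rule nn_integral_monotone_convergence_SUP[symmetric])
         (auto simp: incseq_def le_fun_def intro!: mult_mono expect_mono)
    also have "\<dots> = (\<integral>\<^sup>+\<omega>. indicator A \<omega> * expect_path (SUP i. U i) (X (enn2real (T \<omega>)) \<omega>) * ?J \<omega> \<partial>P x)"
      by (intro nn_integral_cong)
         (simp add: expect_SUP conservative SUP_mult_left_ennreal SUP_mult_right_ennreal)
    finally show ?case .
  qed
  note u_M = measurable_pre_sigma_M[OF T]
  define G where "G = (\<lambda>\<omega>. g (?s \<omega>))"
  define E' where "E' = (\<lambda>\<omega>. expect_path g (X (enn2real (T \<omega>)) \<omega>))"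
  have G_M[measurable]: "G \<in> borel_measurable M"
    unfolding G_def by (rule measurable_compose[OF s g])
  have E'_M[measurable]: "E' \<in> borel_measurable M"
    unfolding E'_def by (rule E[OF g])
  have "(\<integral>\<^sup>+\<omega>. u \<omega> * G \<omega> * ?J \<omega> \<partial>P x) = (\<integral>\<^sup>+\<omega>. u \<omega> * E' \<omega> * ?J \<omega> \<partial>P x)"
    using u
  proof (induction u rule: borel_measurable_induct)
    case (cong f h)
    then show ?case
      by (simp add: space_pre_sigma cong: nn_integral_cong_simp)
  next
    case (set A)
    then show ?case unfolding G_def E'_def by (rule indicator_case[OF g])
  next
    case (mult v c)
    note [measurable] = u_M[OF mult.hyps(2)]
    show ?case
      using mult.IH by (simp add: mult.assoc nn_integral_cmult)
  next
    case (add v v')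
    note [measurable] = u_M[OF add.hyps(1)] u_M[OF add.hyps(3)]
    show ?case
      using add.IH by (simp add: distrib_right nn_integral_add)
  next
    case (seq U)
    note [measurable] = u_M[OF seq.hyps(1)]
    have *: "(\<integral>\<^sup>+\<omega>. (SUP i. U i) \<omega> * f \<omega> * ?J \<omega> \<partial>P x) = (SUP i. \<integral>\<^sup>+\<omega>. U i \<omega> * f \<omega> * ?J \<omega> \<partial>P x)"
      if [measurable]: "f \<in> borel_measurable M" for f
      using seq.hyps(3) unfolding SUP_apply SUP_mult_right_ennreal
      by (intro nn_integral_monotone_convergence_SUP) (auto simp: incseq_def le_fun_def intro!: mult_mono)
    show ?case
      by (simp only: *[OF G_M] *[OF E'_M] seq.IH)
  qed
  then show ?thesis unfolding G_def E'_def .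
qed

definition mean_occ_laplace :: "real \<Rightarrow> nat \<Rightarrow> real \<Rightarrow> ennreal" where
  "mean_occ_laplace l n x = (\<integral>\<^sup>+\<omega>. occ_laplace l n (traj \<omega>) \<partial>P x)"

lemma expect_path_occ_laplace:
  assumes "x \<in> I"
  shows "expect_path (\<lambda>w. occ_laplace l n (grid_limit w)) x = mean_occ_laplace l n x"
  unfolding expect_path_def mean_occ_laplace_def
proof (rule nn_integral_cong)
  fix \<omega> assume "\<omega> \<in> space (P x)"
  then show "occ_laplace l n (grid_limit (\<lambda>s\<in>{0..}. X s \<omega>)) = occ_laplace l n (traj \<omega>)"
    using occ_laplace_shifted_path[of \<omega> 0 l n] by (simp add: space_P[OF assms])
qed

lemma measurable_mean_occ_laplace: "mean_occ_laplace l n \<in> borel_measurable (restrict_space borel I)"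
  unfolding mean_occ_laplace_def by (rule measurable_nn_integral_kernel) (rule measurable_occ_laplace_process[OF measurable_traj])

lemma mean_occ_laplace_le:
  assumes "0 < l" "x \<in> I"
  shows "mean_occ_laplace l n x \<le> ennreal (fact n / l ^ (n + 1))"
proof -
  interpret prob_space "P x" using assms by (intro prob_space_P)
  have "mean_occ_laplace l n x \<le> (\<integral>\<^sup>+\<omega>. ennreal (fact n / l ^ (n + 1)) \<partial>P x)"
    unfolding mean_occ_laplace_def by (intro nn_integral_mono occ_laplace_le assms)
  then show ?thesis by (simp add: emeasure_space_1)
qed

lemma mean_occ_laplace_0:
  assumes "0 < l" "x \<in> I"
  shows "mean_occ_laplace l 0 x = ennreal (1 / l)"
proof -
  interpret prob_space "P x" using assms by (intro prob_space_P)
  show ?thesis unfolding mean_occ_laplace_def occ_laplace_0[OF assms(1)] by (simp add: emeasure_space_1)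
qed

text \<open>The strong Markov property at a constant time, with \<open>1{X\<^sub>s \<ge> 0}\<close> as the known variable.\<close>
lemma Markov_occ_laplace:
  assumes x: "x \<in> I" and "0 \<le> s"
  shows "(\<integral>\<^sup>+\<omega>. indicator {0..} (X s \<omega>) * occ_laplace l n (\<lambda>u. traj \<omega> (s + u)) \<partial>P x)
    = (\<integral>\<^sup>+\<omega>. indicator {0..} (X s \<omega>) * mean_occ_laplace l n (X s \<omega>) \<partial>P x)"
proof -
  let ?T = "\<lambda>_::'w. ennreal s"
  have T: "stopping_time F ?T" by (rule stopping_time_const)
  have u: "(\<lambda>\<omega>. indicator {0..} (X s \<omega>) :: ennreal) \<in> borel_measurable (pre_sigma ?T)"
  proof -
    have "X s \<in> borel_measurable (pre_sigma ?T)"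
    proof (rule measurableI)
      fix A :: "real set" assume "A \<in> sets borel"
      then have A: "X s -` A \<inter> space M \<in> sets (F (ennreal s))"
        using measurable_sets[OF adapted[OF \<open>0 \<le> s\<close>]] by (simp add: space_F)
      show "X s -` A \<inter> space (pre_sigma ?T) \<in> sets (pre_sigma ?T)"
      proof (rule sets_pre_sigmaI[OF T])
        fix t show "{\<omega> \<in> X s -` A \<inter> space (pre_sigma ?T). ennreal s \<le> t} \<in> sets (F t)"
          using A sets_F_mono[of "ennreal s" t] by (cases "ennreal s \<le> t") (auto simp: space_pre_sigma vimage_def Int_def)
      qed
    qed simp
    then show ?thesis by measurable
  qed
  have "(\<integral>\<^sup>+\<omega>. indicator {0..} (X s \<omega>) * occ_laplace l n (\<lambda>u. traj \<omega> (s + u)) \<partial>P x)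
    = (\<integral>\<^sup>+\<omega>. indicator {0..} (X s \<omega>) * (\<lambda>w. occ_laplace l n (grid_limit w)) (\<lambda>r\<in>{0..}. X (enn2real (?T \<omega>) + r) \<omega>)
        * indicator {\<omega>. ?T \<omega> < \<infinity>} \<omega> \<partial>P x)"
    using occ_laplace_shifted_path \<open>0 \<le> s\<close> by (intro nn_integral_cong) (simp add: space_P[OF x])
  also have "\<dots> = (\<integral>\<^sup>+\<omega>. indicator {0..} (X s \<omega>) * expect_path (\<lambda>w. occ_laplace l n (grid_limit w)) (X (enn2real (?T \<omega>)) \<omega>)
        * indicator {\<omega>. ?T \<omega> < \<infinity>} \<omega> \<partial>P x)"
    by (rule strong_Markov_nn_integral[OF x T u measurable_occ_laplace_grid_limit])
  also have "\<dots> = (\<integral>\<^sup>+\<omega>. indicator {0..} (X s \<omega>) * mean_occ_laplace l n (X s \<omega>) \<partial>P x)"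
    using \<open>0 \<le> s\<close> by (intro nn_integral_cong) (simp add: expect_path_occ_laplace conservative space_P[OF x])
  finally show ?thesis .
qed

section \<open>The first hitting time\<close>

text \<open>The set of times at which a continuous path is at \<open>y\<close> is closed, so it contains its infimum.\<close>
lemma hitting_time_attained:
  assumes \<omega>: "\<omega> \<in> space M" and fin: "hitting_time X y \<omega> < \<infinity>"
  obtains h where "0 \<le> h" "hitting_time X y \<omega> = ennreal h" "X h \<omega> = y"
    "\<And>s. 0 \<le> s \<Longrightarrow> s < h \<Longrightarrow> X s \<omega> \<noteq> y"
proof -
  let ?Z = "{s \<in> {0..}. X s \<omega> = y}"
  have "?Z \<noteq> {}"
  proof
    assume "?Z = {}"
    then have "{ennreal t |t. 0 \<le> t \<and> X t \<omega> = y} = {}" by auto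
    then show False using fin unfolding hitting_time_def by (metis Inf_empty infinity_ennreal_def less_irrefl)
  qed
  moreover have "closed ?Z"
    by (rule continuous_closed_preimage_constant[OF continuous_paths[OF \<omega>]]) simp
  moreover have bdd: "bdd_below ?Z" by (rule bdd_belowI[of _ 0]) auto
  ultimately have Z: "Inf ?Z \<in> ?Z" by (intro closed_contains_Inf)
  show ?thesis
  proof (rule that[of "Inf ?Z"])
    show "hitting_time X y \<omega> = ennreal (Inf ?Z)"
      unfolding hitting_time_def
    proof (rule antisym)
      show "Inf {ennreal t |t. 0 \<le> t \<and> X t \<omega> = y} \<le> ennreal (Inf ?Z)"
        using Z by (intro Inf_lower) auto
      show "ennreal (Inf ?Z) \<le> Inf {ennreal t |t. 0 \<le> t \<and> X t \<omega> = y}"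
        using cInf_lower[OF _ bdd] by (intro Inf_greatest) (auto intro!: ennreal_leI)
    qed
    show "X s \<omega> \<noteq> y" if "0 \<le> s" "s < Inf ?Z" for s
      using cInf_lower[OF _ bdd, of s] that by auto
  qed (use Z in auto)
qed

lemma hitting_time_le_iff:
  assumes \<omega>: "\<omega> \<in> space M" and "0 \<le> t"
  shows "hitting_time X y \<omega> \<le> ennreal t \<longleftrightarrow> (\<exists>s\<in>{0..t}. X s \<omega> = y)"
proof
  assume H: "hitting_time X y \<omega> \<le> ennreal t"
  then have "hitting_time X y \<omega> < \<infinity>"
    using ennreal_less_top[of t] unfolding infinity_ennreal_def by (rule le_less_trans)
  then obtain h where h: "0 \<le> h" "hitting_time X y \<omega> = ennreal h" "X h \<omega> = y"
    using hitting_time_attained[OF \<omega>] by blast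
  then have "h \<le> t" using H \<open>0 \<le> t\<close> by (simp add: ennreal_le_iff)
  with h show "\<exists>s\<in>{0..t}. X s \<omega> = y" by auto
next
  assume "\<exists>s\<in>{0..t}. X s \<omega> = y"
  then obtain s where s: "0 \<le> s" "s \<le> t" "X s \<omega> = y" by auto
  have "hitting_time X y \<omega> \<le> ennreal s"
    unfolding hitting_time_def using s by (intro Inf_lower) auto
  also have "\<dots> \<le> ennreal t" using s by (intro ennreal_leI)
  finally show "hitting_time X y \<omega> \<le> ennreal t" .
qed

text \<open>
  A continuous path hits \<open>y\<close> before \<open>r\<close> exactly if it comes arbitrarily close to \<open>y\<close> along a countable
  dense subset of \<open>[0,r]\<close>, by compactness. This is an event of the sigma-algebra at time \<open>r\<close>.
\<close>
lemma stopping_time_hitting_time: "stopping_time F (hitting_time X y)"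
proof (rule stopping_timeI)
  fix t :: ennreal
  show "Measurable.pred (F t) (\<lambda>\<omega>. hitting_time X y \<omega> \<le> t)"
  proof (cases t)
    case top
    then show ?thesis by simp
  next
    case (real r)
    obtain D where D: "countable D" "D \<subseteq> {0..r}" "{0..r} \<subseteq> closure D"
      by (rule separable)
    have "hitting_time X y \<omega> \<le> t \<longleftrightarrow> (\<forall>k. \<exists>q\<in>D. \<bar>X q \<omega> - y\<bar> < 1 / real (Suc k))"
      if "\<omega> \<in> space (F t)" for \<omega>
    proof -
      have \<omega>: "\<omega> \<in> space M" using that by (simp add: space_F)
      have cont: "continuous_on {0..r} (\<lambda>s. X s \<omega>)"
        by (rule continuous_on_subset[OF continuous_paths[OF \<omega>]]) auto
      have "(\<exists>s\<in>{0..r}. X s \<omega> = y) \<longleftrightarrow> (\<forall>k. \<exists>q\<in>D. \<bar>X q \<omega> - y\<bar> < 1 / real (Suc k))"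
      proof (intro iffI allI)
        fix k assume "\<exists>s\<in>{0..r}. X s \<omega> = y"
        then obtain s where s: "s \<in> {0..r}" "X s \<omega> = y" by auto
        obtain d where "d > 0" and d: "\<And>q. q \<in> {0..r} \<Longrightarrow> dist q s < d \<Longrightarrow> dist (X q \<omega>) (X s \<omega>) < 1 / real (Suc k)"
          using cont s(1) unfolding continuous_on_iff by (metis of_nat_0_less_iff zero_less_Suc zero_less_divide_1_iff)
        have "s \<in> closure D" using s D by auto
        then obtain q where "q \<in> D" "dist q s < d"
          using \<open>d > 0\<close> unfolding closure_approachable by blast
        then show "\<exists>q\<in>D. \<bar>X q \<omega> - y\<bar> < 1 / real (Suc k)"
          using d[of q] D(2) s(2) by (intro bexI[of _ q]) (auto simp: dist_real_def)
      next
        assume *: "\<forall>k. \<exists>q\<in>D. \<bar>X q \<omega> - y\<bar> < 1 / real (Suc k)"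
        have "\<exists>s\<in>{0..r}. \<forall>q\<in>{0..r}. \<bar>X s \<omega> - y\<bar> \<le> \<bar>X q \<omega> - y\<bar>"
          using real by (intro continuous_attains_inf) (auto intro!: continuous_intros cont)
        then obtain s where s: "s \<in> {0..r}" and min: "\<And>q. q \<in> {0..r} \<Longrightarrow> \<bar>X s \<omega> - y\<bar> \<le> \<bar>X q \<omega> - y\<bar>"
          by auto
        have "\<bar>X s \<omega> - y\<bar> \<le> 0"
        proof (rule ccontr)
          assume "\<not> \<bar>X s \<omega> - y\<bar> \<le> 0"
          then obtain k where "inverse (real (Suc k)) < \<bar>X s \<omega> - y\<bar>"
            using reals_Archimedean by (meson not_le)
          moreover obtain q where "q \<in> D" "\<bar>X q \<omega> - y\<bar> < 1 / real (Suc k)" using * by blast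
          ultimately show False using min[of q] D(2) by (auto simp: inverse_eq_divide)
        qed
        then show "\<exists>s\<in>{0..r}. X s \<omega> = y" using s by auto
      qed
      then show ?thesis using hitting_time_le_iff[OF \<omega>] real by simp
    qed
    moreover have "Measurable.pred (F t) (\<lambda>\<omega>. \<forall>k. \<exists>q\<in>D. \<bar>X q \<omega> - y\<bar> < 1 / real (Suc k))"
    proof (intro pred_intros_countable(1) measurable_pred_countable(2) D(1))
      fix k q assume "q \<in> D"
      then have "0 \<le> q" "ennreal q \<le> t" using D(2) real by (auto intro: ennreal_leI)
      then have "X q \<in> borel_measurable (F t)"
        using adapted[OF \<open>0 \<le> q\<close>] sets_F_mono[OF \<open>ennreal q \<le> t\<close>] by (auto simp: measurable_def space_F)
      then show "Measurable.pred (F t) (\<lambda>\<omega>. \<bar>X q \<omega> - y\<bar> < 1 / real (Suc k))" by measurable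
    qed
    ultimately show ?thesis by (simp cong: measurable_cong)
  qed
qed

abbreviation H :: "'w \<Rightarrow> ennreal" where "H \<equiv> hitting_time X 0"

text \<open>The variable \<open>e\<^sup>-\<^sup>\<lambda>\<^sup>H H\<^sup>k\<close>, with the value \<open>0\<close> on \<open>H = \<infinity>\<close> also for \<open>k = 0\<close>.\<close>
definition hitting_weight :: "real \<Rightarrow> nat \<Rightarrow> 'w \<Rightarrow> real" where
  "hitting_weight l k \<omega> = (if H \<omega> = \<infinity> then 0 else exp (- l * enn2real (H \<omega>)) * enn2real (H \<omega>) ^ k)"

lemma hitting_weight_nonneg: "0 \<le> hitting_weight l k \<omega>"
  by (simp add: hitting_weight_def)

lemma measurable_H_pre_sigma: "H \<in> borel_measurable (pre_sigma H)"
  by (rule measurable_stopping_time_pre_sigma[OF stopping_time_hitting_time])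

lemma measurable_hitting_weight_pre_sigma: "hitting_weight l k \<in> borel_measurable (pre_sigma H)"
  unfolding hitting_weight_def using measurable_H_pre_sigma by measurable

lemma measurable_hitting_weight: "hitting_weight l k \<in> borel_measurable M"
  by (rule measurable_pre_sigma_M[OF stopping_time_hitting_time measurable_hitting_weight_pre_sigma])

definition hitting_moment :: "real \<Rightarrow> nat \<Rightarrow> real \<Rightarrow> ennreal" where
  "hitting_moment l k y = (\<integral>\<^sup>+\<omega>. ennreal (hitting_weight l k \<omega>) \<partial>P y)"

lemma measurable_hitting_moment: "hitting_moment l k \<in> borel_measurable (restrict_space borel I)"
  unfolding hitting_moment_def using measurable_hitting_weight[of l k]
  by (intro measurable_nn_integral_kernel) simp

lemma AE_start:
  assumes "y \<in> I" shows "AE \<omega> in P y. X 0 \<omega> = y"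
proof -
  interpret prob_space "P y" using assms by (rule prob_space_P)
  have "prob {\<omega> \<in> space M. X 0 \<omega> = y} = 1"
    using start[OF assms] by (simp add: emeasure_eq_measure)
  then show ?thesis by (auto dest: AE_prob_1)
qed

text \<open>
  By the intermediate value theorem the path cannot become negative before \<open>H\<close>. On \<open>H = \<infinity>\<close> it never
  does, so that \<open>A\<^sub>t = t\<close> for all \<open>t\<close>, and both sums vanish.
\<close>
lemma occ_laplace_traj_passage:
  assumes "0 < l" and \<omega>: "\<omega> \<in> space M" and "0 \<le> X 0 \<omega>"
  shows "occ_laplace l n (traj \<omega>) + (\<Sum>j\<le>n. of_nat (n choose j) * ennreal (hitting_weight l (n - j) \<omega>) * ennreal (fact j / l ^ (j + 1)))
    = ennreal (fact n / l ^ (n + 1))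
      + (\<Sum>j\<le>n. of_nat (n choose j) * (ennreal (hitting_weight l (n - j) \<omega>) * occ_laplace l j (\<lambda>u. traj \<omega> (enn2real (H \<omega>) + u))
          * indicator {\<omega>. H \<omega> < \<infinity>} \<omega>))"
proof -
  have nonneg: "0 \<le> traj \<omega> s" if "0 \<le> s" and no_zero: "\<And>r. 0 \<le> r \<Longrightarrow> r < s \<Longrightarrow> X r \<omega> \<noteq> 0" for s
  proof (rule ccontr)
    assume "\<not> 0 \<le> traj \<omega> s"
    then have "X s \<omega> < 0" using traj_eq[OF \<omega>] that(1) by simp
    moreover have "continuous_on {0..s} (\<lambda>s. X s \<omega>)"
      by (rule continuous_on_subset[OF continuous_paths[OF \<omega>]]) auto
    ultimately obtain r where "0 \<le> r" "r \<le> s" "X r \<omega> = 0"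
      using IVT2'[of "\<lambda>s. X s \<omega>" s 0 0] assms(3) \<open>0 \<le> s\<close> by auto
    with no_zero[of r] \<open>X s \<omega> < 0\<close> show False by (cases "r = s") auto
  qed
  show ?thesis
  proof (cases "H \<omega> < \<infinity>")
    case True
    then obtain h where h: "0 \<le> h" "H \<omega> = ennreal h" "\<And>s. 0 \<le> s \<Longrightarrow> s < h \<Longrightarrow> X s \<omega> \<noteq> 0"
      using hitting_time_attained[OF \<omega>] by blast
    have "hitting_weight l k \<omega> = exp (- l * h) * h ^ k" for k
      unfolding hitting_weight_def h(2) using h(1) by simp
    moreover have "0 \<le> traj \<omega> s" if "0 \<le> s" "s < h" for s
      using that h(3) by (intro nonneg) auto
    ultimately show ?thesis
      using occ_laplace_passage[OF \<open>0 < l\<close> grid_limit_borel h(1), of "\<lambda>t. X t \<omega>" n] True h(1,2) by (simp add: mult.assoc)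
  next
    case False
    then have inf: "H \<omega> = \<infinity>" by (simp add: less_top[symmetric])
    have "X r \<omega> \<noteq> 0" if "0 \<le> r" for r
      using hitting_time_le_iff[OF \<omega> that, of 0] that inf by (auto simp: top_unique)
    then have "occ (traj \<omega>) t = ennreal t" if "0 \<le> t" for t
      using that by (intro occ_eq_time nonneg) auto
    then have "occ_laplace l n (traj \<omega>) = (\<integral>\<^sup>+t. ennreal (t ^ n * exp (- l * t)) * indicator {0..} t \<partial>lborel)"
      unfolding occ_laplace_def by (intro nn_integral_cong)
        (auto split: split_indicator simp: ennreal_mult' ennreal_power mult.commute)
    then show ?thesis
      using nn_integral_power_exp_Ici[OF \<open>0 < l\<close>, of n] inf by (simp add: hitting_weight_def)
  qed
qed

text \<open>
  Take expectations in the pathwise identity. The process is at \<open>0\<close> at time \<open>H\<close>, so the strong Markov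
  property replaces the functional of the restarted path by its mean under \<open>P\<^sub>0\<close>.
\<close>
lemma mean_occ_laplace_passage:
  assumes "0 < l" "0 \<in> I" and y: "y \<in> I" "0 \<le> y"
  shows "mean_occ_laplace l n y + (\<Sum>j\<le>n. of_nat (n choose j) * hitting_moment l (n - j) y * ennreal (fact j / l ^ (j + 1)))
    = ennreal (fact n / l ^ (n + 1)) + (\<Sum>j\<le>n. of_nat (n choose j) * (hitting_moment l (n - j) y * mean_occ_laplace l j 0))"
proof -
  interpret prob_space "P y" using y(1) by (rule prob_space_P)
  note T = stopping_time_hitting_time[of 0]
  note [simp] = measurable_P[OF y(1)]
  note [measurable] = measurable_hitting_weight measurable_occ_laplace_process[OF measurable_traj] stopping_time_measurable[OF T]
  let ?J = "indicator {\<omega>. H \<omega> < \<infinity>} :: 'w \<Rightarrow> ennreal"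
  have shift_M: "(\<lambda>\<omega>. occ_laplace l j (\<lambda>u. traj \<omega> (enn2real (H \<omega>) + u))) \<in> borel_measurable M" for j
  proof -
    have "(\<lambda>\<omega>. occ_laplace l j (grid_limit (\<lambda>s\<in>{0..}. X (enn2real (H \<omega>) + s) \<omega>))) \<in> borel_measurable M"
      by (rule measurable_compose[OF measurable_shifted_path measurable_occ_laplace_grid_limit]) auto
    then show ?thesis by (simp add: occ_laplace_shifted_path cong: measurable_cong del: restrict_apply)
  qed
  note [measurable] = shift_M
  have strong: "(\<integral>\<^sup>+\<omega>. ennreal (hitting_weight l k \<omega>) * occ_laplace l j (\<lambda>u. traj \<omega> (enn2real (H \<omega>) + u)) * ?J \<omega> \<partial>P y)
     = hitting_moment l k y * mean_occ_laplace l j 0" for j k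
  proof -
    have "(\<integral>\<^sup>+\<omega>. ennreal (hitting_weight l k \<omega>) * occ_laplace l j (\<lambda>u. traj \<omega> (enn2real (H \<omega>) + u)) * ?J \<omega> \<partial>P y)
      = (\<integral>\<^sup>+\<omega>. ennreal (hitting_weight l k \<omega>) * (\<lambda>w. occ_laplace l j (grid_limit w)) (\<lambda>s\<in>{0..}. X (enn2real (H \<omega>) + s) \<omega>) * ?J \<omega> \<partial>P y)"
      by (intro nn_integral_cong) (simp add: occ_laplace_shifted_path space_P[OF y(1)] del: restrict_apply)
    also have "\<dots> = (\<integral>\<^sup>+\<omega>. ennreal (hitting_weight l k \<omega>) * expect_path (\<lambda>w. occ_laplace l j (grid_limit w)) (X (enn2real (H \<omega>)) \<omega>) * ?J \<omega> \<partial>P y)"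
      using measurable_hitting_weight_pre_sigma[of l k]
      by (intro strong_Markov_nn_integral[OF y(1) T _ measurable_occ_laplace_grid_limit]) simp
    also have "\<dots> = (\<integral>\<^sup>+\<omega>. ennreal (hitting_weight l k \<omega>) * mean_occ_laplace l j 0 \<partial>P y)"
    proof (rule nn_integral_cong)
      fix \<omega> assume "\<omega> \<in> space (P y)"
      then have \<omega>: "\<omega> \<in> space M" by (simp add: space_P[OF y(1)])
      show "ennreal (hitting_weight l k \<omega>) * expect_path (\<lambda>w. occ_laplace l j (grid_limit w)) (X (enn2real (H \<omega>)) \<omega>) * ?J \<omega>
        = ennreal (hitting_weight l k \<omega>) * mean_occ_laplace l j 0"
      proof (cases "H \<omega> < \<infinity>")
        case True
        then obtain h where h: "0 \<le> h" "H \<omega> = ennreal h" "X h \<omega> = 0"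
          using hitting_time_attained[OF \<omega>] by blast
        then show ?thesis using True by (simp add: expect_path_occ_laplace[OF \<open>0 \<in> I\<close>])
      next
        case False
        then show ?thesis by (simp add: hitting_weight_def less_top[symmetric])
      qed
    qed
    also have "\<dots> = hitting_moment l k y * mean_occ_laplace l j 0"
      unfolding hitting_moment_def by (rule nn_integral_multc) simp
    finally show ?thesis .
  qed
  have "mean_occ_laplace l n y + (\<Sum>j\<le>n. of_nat (n choose j) * hitting_moment l (n - j) y * ennreal (fact j / l ^ (j + 1)))
    = (\<integral>\<^sup>+\<omega>. occ_laplace l n (traj \<omega>) + (\<Sum>j\<le>n. of_nat (n choose j) * ennreal (hitting_weight l (n - j) \<omega>)
        * ennreal (fact j / l ^ (j + 1))) \<partial>P y)"
    unfolding mean_occ_laplace_def hitting_moment_def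
    by (simp add: nn_integral_add nn_integral_sum nn_integral_cmult nn_integral_multc)
  also have "\<dots> = (\<integral>\<^sup>+\<omega>. ennreal (fact n / l ^ (n + 1))
      + (\<Sum>j\<le>n. of_nat (n choose j) * (ennreal (hitting_weight l (n - j) \<omega>)
          * occ_laplace l j (\<lambda>u. traj \<omega> (enn2real (H \<omega>) + u)) * ?J \<omega>)) \<partial>P y)"
  proof (rule nn_integral_cong_AE)
    show "AE \<omega> in P y. occ_laplace l n (traj \<omega>) + (\<Sum>j\<le>n. of_nat (n choose j) * ennreal (hitting_weight l (n - j) \<omega>)
        * ennreal (fact j / l ^ (j + 1))) = ennreal (fact n / l ^ (n + 1))
      + (\<Sum>j\<le>n. of_nat (n choose j) * (ennreal (hitting_weight l (n - j) \<omega>)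
          * occ_laplace l j (\<lambda>u. traj \<omega> (enn2real (H \<omega>) + u)) * ?J \<omega>))"
      using AE_start[OF y(1)] AE_space
    proof eventually_elim
      case (elim \<omega>)
      then show ?case using y(2) by (intro occ_laplace_traj_passage[OF \<open>0 < l\<close>]) (auto simp: space_P[OF y(1)])
    qed
  qed
  also have "\<dots> = ennreal (fact n / l ^ (n + 1))
      + (\<Sum>j\<le>n. of_nat (n choose j) * (\<integral>\<^sup>+\<omega>. ennreal (hitting_weight l (n - j) \<omega>)
          * occ_laplace l j (\<lambda>u. traj \<omega> (enn2real (H \<omega>) + u)) * ?J \<omega> \<partial>P y))"
    by (simp add: nn_integral_add nn_integral_sum nn_integral_cmult emeasure_space_1)
  finally show ?thesis unfolding strong .
qed

end

section \<open>Derivatives of the hitting transform\<close>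

text \<open>One term of the exponential series of \<open>l h\<close> is at most the whole sum.\<close>
lemma power_times_exp_le:
  fixes l h :: real
  assumes "0 < l" "0 \<le> h"
  shows "exp (- l * h) * h ^ k \<le> fact k / l ^ k"
proof -
  have "(l * h) ^ k / fact k \<le> (\<Sum>n\<le>k. (l * h) ^ n / fact n)"
    using assms by (intro member_le_sum) auto
  also have "\<dots> \<le> exp (l * h)"
    using sum_le_suminf[OF summable_exp[of "l * h"], of "{..k}"] assms
    by (simp add: exp_def divide_inverse mult.commute)
  finally have "(l * h) ^ k \<le> fact k * exp (l * h)" by (simp add: divide_le_eq mult.commute)
  then show ?thesis
    using assms by (simp add: exp_minus field_simps power_mult_distrib)
qed

text \<open>For \<open>a < b\<close>, \<open>e\<^sup>-\<^sup>a\<^sup>h - e\<^sup>-\<^sup>b\<^sup>h = e\<^sup>-\<^sup>a\<^sup>h (1 - e\<^sup>-\<^sup>(\<^sup>b\<^sup>-\<^sup>a\<^sup>)\<^sup>h)\<close>, and \<open>1 - e\<^sup>-\<^sup>x \<le> x\<close>.\<close>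
lemma exp_difference_quotient_le:
  fixes l m h :: real
  assumes "0 < l" "l / 2 < m" "m \<noteq> l" "0 \<le> h"
  shows "\<bar>(exp (- m * h) - exp (- l * h)) / (m - l)\<bar> \<le> exp (- (l / 2) * h) * h"
proof -
  have main: "exp (- a * h) - exp (- b * h) \<le> exp (- (l / 2) * h) * h * (b - a)"
    if "l / 2 \<le> a" "a < b" for a b
  proof -
    have "exp (- a * h) - exp (- b * h) = exp (- a * h) * (1 - exp (- (b - a) * h))"
      by (simp add: algebra_simps mult_exp_exp)
    also have "\<dots> \<le> exp (- a * h) * ((b - a) * h)"
    proof (rule mult_left_mono)
      have "1 + (- (b - a) * h) \<le> exp (- (b - a) * h)" by (rule exp_ge_add_one_self)
      then show "1 - exp (- (b - a) * h) \<le> (b - a) * h" by linarith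
    qed simp
    also have "\<dots> \<le> exp (- (l / 2) * h) * ((b - a) * h)"
    proof (rule mult_right_mono)
      have "l / 2 * h \<le> a * h" using that assms by (intro mult_right_mono) auto
      then show "exp (- a * h) \<le> exp (- (l / 2) * h)" by simp
    qed (use that assms in simp)
    finally show ?thesis by (simp add: mult_ac)
  qed
  show ?thesis
  proof (cases "m < l")
    case True
    then have "exp (- l * h) \<le> exp (- m * h)" using assms by (auto intro!: mult_right_mono)
    with True show ?thesis
      using main[of m l] assms by (simp add: abs_divide divide_le_eq)
  next
    case False
    then have "exp (- m * h) \<le> exp (- l * h)" using assms by (auto intro!: mult_right_mono)
    with False show ?thesis
      using main[of l m] assms by (simp add: abs_divide divide_le_eq)
  qed
qed

context regular_diffusion
begin

lemma hitting_weight_le: "0 < l \<Longrightarrow> hitting_weight l k \<omega> \<le> fact k / l ^ k"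
  using power_times_exp_le[of l "enn2real (H \<omega>)" k] by (auto simp: hitting_weight_def)

lemma integrable_hitting_weight:
  assumes "0 < l" "y \<in> I"
  shows "integrable (P y) (hitting_weight l k)"
proof -
  interpret prob_space "P y" using assms(2) by (rule prob_space_P)
  show ?thesis
    using hitting_weight_le[OF assms(1), of k] hitting_weight_nonneg measurable_hitting_weight
    by (intro integrable_const_bound[where B = "fact k / l ^ k"]) (auto simp: measurable_P[OF assms(2)])
qed

text \<open>
  Differentiation under the integral sign, by dominated convergence of the difference quotients.
  For parameters above \<open>l/2\<close> they are bounded by \<open>e\<^sup>-\<^sup>l\<^sup>H\<^sup>/\<^sup>2 H\<^sup>k\<^sup>+\<^sup>1\<close>, hence by a constant.
\<close>
lemma DERIV_integral_hitting_weight: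
  assumes l: "0 < l" and y: "y \<in> I"
  shows "((\<lambda>l. \<integral>\<omega>. hitting_weight l k \<omega> \<partial>P y) has_real_derivative - (\<integral>\<omega>. hitting_weight l (Suc k) \<omega> \<partial>P y)) (at l)"
proof -
  interpret prob_space "P y" using y by (rule prob_space_P)
  note [simp] = measurable_P[OF y]
  have "((\<lambda>m. ((\<integral>\<omega>. hitting_weight m k \<omega> \<partial>P y) - (\<integral>\<omega>. hitting_weight l k \<omega> \<partial>P y)) / (m - l))
      \<longlongrightarrow> (\<integral>\<omega>. - hitting_weight l (Suc k) \<omega> \<partial>P y)) (at l within {l / 2<..})"
    unfolding tendsto_at_iff_sequentially
  proof (intro allI impI)
    fix a :: "nat \<Rightarrow> real"
    assume a: "\<forall>i. a i \<in> {l / 2<..} - {l}" and lim: "a \<longlonglongrightarrow> l"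
    let ?q = "\<lambda>i \<omega>. (hitting_weight (a i) k \<omega> - hitting_weight l k \<omega>) / (a i - l)"
    have "(\<lambda>i. \<integral>\<omega>. ?q i \<omega> \<partial>P y) \<longlonglongrightarrow> (\<integral>\<omega>. - hitting_weight l (Suc k) \<omega> \<partial>P y)"
    proof (rule integral_dominated_convergence)
      show "integrable (P y) (\<lambda>\<omega>. fact (Suc k) / (l / 2) ^ Suc k)" by simp
      show "AE \<omega> in P y. (\<lambda>i. ?q i \<omega>) \<longlonglongrightarrow> - hitting_weight l (Suc k) \<omega>"
      proof (rule AE_I2)
        fix \<omega>
        have "((\<lambda>m. hitting_weight m k \<omega>) has_real_derivative - hitting_weight l (Suc k) \<omega>) (at l)"
          by (cases "H \<omega> = \<infinity>") (auto simp: hitting_weight_def intro!: derivative_eq_intros)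
        then have "((\<lambda>m. (hitting_weight m k \<omega> - hitting_weight l k \<omega>) / (m - l)) \<longlongrightarrow> - hitting_weight l (Suc k) \<omega>) (at l)"
          by (simp add: has_field_derivative_iff)
        then show "(\<lambda>i. ?q i \<omega>) \<longlonglongrightarrow> - hitting_weight l (Suc k) \<omega>"
          using a lim unfolding tendsto_at_iff_sequentially comp_def by auto
      qed
      show "AE \<omega> in P y. norm (?q i \<omega>) \<le> fact (Suc k) / (l / 2) ^ Suc k" for i
      proof (rule AE_I2)
        fix \<omega>
        let ?h = "enn2real (H \<omega>)"
        show "norm (?q i \<omega>) \<le> fact (Suc k) / (l / 2) ^ Suc k"
        proof (cases "H \<omega> = \<infinity>")
          case True
          then show ?thesis using l by (simp add: hitting_weight_def)
        next
          case False
          then have "?q i \<omega> = (exp (- a i * ?h) - exp (- l * ?h)) / (a i - l) * ?h ^ k"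
            by (simp add: hitting_weight_def left_diff_distrib)
          then have "norm (?q i \<omega>) = \<bar>(exp (- a i * ?h) - exp (- l * ?h)) / (a i - l)\<bar> * ?h ^ k"
            by (simp only: real_norm_def abs_mult) simp
          also have "\<dots> \<le> exp (- (l / 2) * ?h) * ?h * ?h ^ k"
            using a l by (intro mult_right_mono exp_difference_quotient_le) auto
          also have "\<dots> \<le> fact (Suc k) / (l / 2) ^ Suc k"
            using power_times_exp_le[of "l / 2" ?h "Suc k"] l by (simp add: mult_ac)
          finally show ?thesis .
        qed
      qed
    qed (auto intro!: borel_measurable_divide borel_measurable_diff borel_measurable_uminus measurable_hitting_weight)
    also have "(\<lambda>i. \<integral>\<omega>. ?q i \<omega> \<partial>P y) = (\<lambda>m. ((\<integral>\<omega>. hitting_weight m k \<omega> \<partial>P y) - (\<integral>\<omega>. hitting_weight l k \<omega> \<partial>P y)) / (m - l)) \<circ> a"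
    proof
      fix i
      have "0 < a i" using a[rule_format, of i] l by simp
      then show "(\<integral>\<omega>. ?q i \<omega> \<partial>P y) = ((\<lambda>m. ((\<integral>\<omega>. hitting_weight m k \<omega> \<partial>P y) - (\<integral>\<omega>. hitting_weight l k \<omega> \<partial>P y)) / (m - l)) \<circ> a) i"
        using integrable_hitting_weight[OF _ y] l by simp
    qed
    finally show "\<dots> \<longlonglongrightarrow> (\<integral>\<omega>. - hitting_weight l (Suc k) \<omega> \<partial>P y)" .
  qed
  moreover have "at l within {l / 2<..} = at l"
    using l by (intro at_within_open) auto
  ultimately show ?thesis
    unfolding has_field_derivative_iff by simp
qed

lemma higher_deriv_hitting_laplace:
  assumes "y \<in> I" "0 < l"
  shows "(deriv ^^ k) (hitting_laplace P X y) l = (- 1) ^ k * (\<integral>\<omega>. hitting_weight l k \<omega> \<partial>P y)"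
  using assms(2)
proof (induction k arbitrary: l)
  case 0
  show ?case
    by (auto simp: hitting_laplace_def hitting_weight_def intro!: Bochner_Integration.integral_cong)
next
  case (Suc k)
  have "\<forall>\<^sub>F m in nhds l. (deriv ^^ k) (hitting_laplace P X y) m = (- 1) ^ k * (\<integral>\<omega>. hitting_weight m k \<omega> \<partial>P y)"
  proof (rule eventually_mono)
    show "\<forall>\<^sub>F m in nhds l. m \<in> {0<..}"
      using Suc.prems by (intro eventually_nhds_in_open) auto
  qed (use Suc.IH in auto)
  then have "(deriv ^^ Suc k) (hitting_laplace P X y) l = deriv (\<lambda>m. (- 1) ^ k * (\<integral>\<omega>. hitting_weight m k \<omega> \<partial>P y)) l"
    by (simp add: deriv_cong_ev)
  also have "\<dots> = (- 1) ^ Suc k * (\<integral>\<omega>. hitting_weight l (Suc k) \<omega> \<partial>P y)"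
    using DERIV_cmult[OF DERIV_integral_hitting_weight[OF Suc.prems assms(1)], of "(- 1) ^ k" k]
    by (intro DERIV_imp_deriv) simp
  finally show ?case .
qed

lemma hitting_moment_eq:
  assumes "0 < l" "y \<in> I"
  shows "hitting_moment l k y = ennreal (\<integral>\<omega>. hitting_weight l k \<omega> \<partial>P y)"
  unfolding hitting_moment_def
  by (rule nn_integral_eq_integral[OF integrable_hitting_weight[OF assms]]) (simp add: hitting_weight_nonneg)

lemma hitting_moment_le:
  assumes "0 < l" "y \<in> I"
  shows "hitting_moment l k y \<le> ennreal (fact k / l ^ k)"
proof -
  interpret prob_space "P y" using assms(2) by (rule prob_space_P)
  have "hitting_moment l k y \<le> (\<integral>\<^sup>+\<omega>. ennreal (fact k / l ^ k) \<partial>P y)"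
    unfolding hitting_moment_def using hitting_weight_le[OF assms(1)]
    by (intro nn_integral_mono ennreal_leI)
  then show ?thesis by (simp add: emeasure_space_1)
qed

section \<open>The speed measure is sigma-finite\<close>

lemma I_borel: "I \<in> sets borel"
  using interval(1) by (rule real_interval_borel_measurable)

lemma exists_other_point: "\<exists>y\<in>I. y \<noteq> x"
proof -
  obtain c e where c: "0 < e" "ball c e \<subseteq> I"
    using interval(2) unfolding mem_interior by (metis all_not_in_conv mem_interior)
  then have "c \<in> I" "c + e / 2 \<in> I" by (auto simp: dist_real_def intro!: subsetD[OF c(2)])
  moreover have "c \<noteq> x \<or> c + e / 2 \<noteq> x" using c(1) by auto
  ultimately show ?thesis by blast
qed

text \<open>
  The speed measure is finite on compact intervals with endpoints in \<open>I\<close>. Countably many of them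
  cover \<open>I\<close>: take as endpoints the rationals in \<open>I\<close> and the endpoints of \<open>I\<close> that belong to \<open>I\<close>.
\<close>
lemma sigma_finite_speed_measure:
  assumes "speed_measure I P X S m"
  shows "sigma_finite_measure m"
proof
  have sets_m: "sets m = sets borel" and null: "emeasure m (- I) = 0"
    and fin: "\<And>a b. a \<in> I \<Longrightarrow> b \<in> I \<Longrightarrow> a < b \<Longrightarrow> emeasure m {a..b} < \<infinity>"
    using assms unfolding speed_measure_def by blast+
  have space_m: "space m = UNIV" using sets_eq_imp_space_eq[OF sets_m] by simp
  define C where "C = (\<rat> \<inter> I) \<union> {x \<in> I. \<forall>z\<in>I. x \<le> z} \<union> {x \<in> I. \<forall>z\<in>I. z \<le> x}"
  have "countable {x \<in> I. \<forall>z\<in>I. x \<le> z}"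
  proof (cases "{x \<in> I. \<forall>z\<in>I. x \<le> z} = {}")
    case False
    then obtain x where "{x \<in> I. \<forall>z\<in>I. x \<le> z} = {x}" by (auto intro: antisym)
    then show ?thesis by simp
  qed (simp only: countable_empty)
  moreover have "countable {x \<in> I. \<forall>z\<in>I. z \<le> x}"
  proof (cases "{x \<in> I. \<forall>z\<in>I. z \<le> x} = {}")
    case False
    then obtain x where "{x \<in> I. \<forall>z\<in>I. z \<le> x} = {x}" by (auto intro: antisym)
    then show ?thesis by simp
  qed (simp only: countable_empty)
  ultimately have C: "countable C"
    unfolding C_def using countable_rat by (auto intro: countable_subset[of "\<rat> \<inter> I" \<rat>])
  define A where "A = insert (- I) {{a..b} | a b. a \<in> C \<and> b \<in> C \<and> a < b}"
  have cover: "\<exists>a\<in>C. \<exists>b\<in>C. a < b \<and> a \<le> x \<and> x \<le> b" if x: "x \<in> I" for x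
  proof -
    have between: "z \<in> I" if "a \<in> I" "b \<in> I" "a < z" "z < b" for a b z
      using interval(1) that unfolding is_interval_1 by (meson less_imp_le)
    have other: "\<exists>z\<in>I. z \<noteq> x" by (rule exists_other_point)
    \<comment> \<open>The inequalities are strict on each side where \<open>I\<close> has a point, hence on one side at least.\<close>
    have lower: "\<exists>a\<in>C. a \<le> x \<and> ((\<exists>z\<in>I. z < x) \<longrightarrow> a < x)"
    proof (cases "\<exists>z\<in>I. z < x")
      case True
      then obtain z q where "z \<in> I" "z < x" "q \<in> \<rat>" "z < q" "q < x" using Rats_dense_in_real by blast
      then show ?thesis using between[of z x q] x by (intro bexI[of _ q]) (auto simp: C_def)
    next
      case False
      then show ?thesis using x by (intro bexI[of _ x]) (auto simp: C_def not_less)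
    qed
    have upper: "\<exists>b\<in>C. x \<le> b \<and> ((\<exists>z\<in>I. x < z) \<longrightarrow> x < b)"
    proof (cases "\<exists>z\<in>I. x < z")
      case True
      then obtain z q where "z \<in> I" "x < z" "q \<in> \<rat>" "x < q" "q < z" using Rats_dense_in_real by blast
      then show ?thesis using between[of x z q] x by (intro bexI[of _ q]) (auto simp: C_def)
    next
      case False
      then show ?thesis using x by (intro bexI[of _ x]) (auto simp: C_def not_less)
    qed
    from lower upper obtain a b where ab: "a \<in> C" "a \<le> x" "(\<exists>z\<in>I. z < x) \<longrightarrow> a < x"
      "b \<in> C" "x \<le> b" "(\<exists>z\<in>I. x < z) \<longrightarrow> x < b" by blast
    moreover have "(\<exists>z\<in>I. z < x) \<or> (\<exists>z\<in>I. x < z)" using other by (meson linorder_neqE)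
    ultimately have "a < b" by force
    with ab show ?thesis by blast
  qed
  show "\<exists>A. countable A \<and> A \<subseteq> sets m \<and> \<Union> A = space m \<and> (\<forall>a\<in>A. emeasure m a \<noteq> \<infinity>)"
  proof (intro exI[of _ A] conjI)
    have "{{a..b} | a b. a \<in> C \<and> b \<in> C \<and> a < b} \<subseteq> (\<lambda>(a, b). {a..b}) ` (C \<times> C)"
      by auto
    moreover have "countable ((\<lambda>(a, b). {a..b}) ` (C \<times> C))"
      using C by simp
    ultimately show "countable A"
      unfolding A_def by (intro countable_insert) (rule countable_subset)
    show "A \<subseteq> sets m" unfolding A_def sets_m using I_borel by auto
    show "\<Union> A = space m"
    proof
      show "space m \<subseteq> \<Union> A"
      proof
        fix x
        show "x \<in> \<Union> A"
        proof (cases "x \<in> I")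
          case True
          then obtain a b where "a \<in> C" "b \<in> C" "a < b" "x \<in> {a..b}" using cover by fastforce
          then show ?thesis unfolding A_def by blast
        qed (simp add: A_def)
      qed
    qed (simp add: space_m)
    show "\<forall>a\<in>A. emeasure m a \<noteq> \<infinity>"
    proof
      fix B assume "B \<in> A"
      then consider "B = - I" | a b where "a \<in> C" "b \<in> C" "a < b" "B = {a..b}"
        unfolding A_def by blast
      then show "emeasure m B \<noteq> \<infinity>"
      proof cases
        case 1
        then show ?thesis using null by simp
      next
        case (2 a b)
        then have "a \<in> I" "b \<in> I" by (auto simp: C_def)
        then show ?thesis using fin[of a b] 2 by simp
      qed
    qed
  qed
qed

section \<open>Moments of the occupation time as extended integrals\<close>

lemma occupation_time_eq: "\<omega> \<in> space M \<Longrightarrow> occupation_time X t \<omega> = enn2real (occ (traj \<omega>) t)"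
  unfolding occupation_time_def occ_def measure_def
  by (intro arg_cong[where f = "\<lambda>A. enn2real (emeasure lborel A)"]) (auto simp: traj_eq)

lemma ennreal_occupation_time:
  assumes "\<omega> \<in> space M" shows "ennreal (occupation_time X t \<omega>) = occ (traj \<omega>) t"
proof -
  have "occ (traj \<omega>) t < top"
    using occ_le ennreal_less_top by (rule le_less_trans)
  then show ?thesis by (simp add: occupation_time_eq[OF assms])
qed

lemma occupation_time_nonneg: "0 \<le> occupation_time X t \<omega>"
  by (simp add: occupation_time_def)

lemma measurable_occ_path: "(\<lambda>x. occ (traj (fst x)) (snd x)) \<in> borel_measurable (M \<Otimes>\<^sub>M borel)"
  by (rule measurable_occ_process[OF measurable_traj])

lemma measurable_occ_path_slice: "(\<lambda>\<omega>. occ (traj \<omega>) t) \<in> borel_measurable M"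
  using measurable_compose[OF _ measurable_occ_path, of "\<lambda>\<omega>. (\<omega>, t)" M] by simp

lemma occupation_moment_eq:
  assumes "0 \<in> I"
  shows "ennreal (occupation_moment P X t n) = (\<integral>\<^sup>+\<omega>. occ (traj \<omega>) t ^ n \<partial>P 0)"
proof -
  interpret prob_space "P 0" using assms by (rule prob_space_P)
  have "(\<lambda>\<omega>. enn2real (occ (traj \<omega>) t)) \<in> borel_measurable M"
    using measurable_occ_path_slice[of t] by measurable
  then have meas: "occupation_time X t \<in> borel_measurable M"
    by (simp add: occupation_time_eq cong: measurable_cong)
  have bound: "occupation_time X t \<omega> \<le> max 0 t" if "\<omega> \<in> space M" for \<omega>
  proof -
    have "ennreal (occupation_time X t \<omega>) \<le> ennreal t"
      using ennreal_occupation_time[OF that] occ_le by simp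
    then show ?thesis
      by (cases "0 \<le> t") (auto simp: ennreal_le_iff occupation_time_nonneg ennreal_neg)
  qed
  have "integrable (P 0) (\<lambda>\<omega>. occupation_time X t \<omega> ^ n)"
    using bound occupation_time_nonneg meas
    by (intro integrable_const_bound[where B = "max 0 t ^ n"])
       (auto simp: measurable_P[OF assms] space_P[OF assms] intro!: AE_I2 power_mono)
  then have "ennreal (occupation_moment P X t n) = (\<integral>\<^sup>+\<omega>. ennreal (occupation_time X t \<omega> ^ n) \<partial>P 0)"
    unfolding occupation_moment_def
    by (intro nn_integral_eq_integral[symmetric]) (simp_all add: occupation_time_nonneg)
  also have "\<dots> = (\<integral>\<^sup>+\<omega>. occ (traj \<omega>) t ^ n \<partial>P 0)"
    by (intro nn_integral_cong)
       (simp add: ennreal_occupation_time[symmetric] space_P[OF assms] ennreal_power occupation_time_nonneg)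
  finally show ?thesis .
qed

lemma occupation_moment_nonneg: "0 \<le> occupation_moment P X t n"
  unfolding occupation_moment_def by (simp add: occupation_time_nonneg)

text \<open>The expectation and the time integral are exchanged by Fubini's theorem.\<close>
lemma occupation_moment_laplace_eq:
  assumes "0 \<in> I"
  shows "occupation_moment_laplace P X l n = enn2real (mean_occ_laplace l n 0)"
proof -
  interpret prob_space "P 0" using assms by (rule prob_space_P)
  interpret pair_sigma_finite "P 0" lborel ..
  have sets_pair: "sets (P 0 \<Otimes>\<^sub>M lborel) = sets (M \<Otimes>\<^sub>M borel)"
    by (rule sets_pair_measure_cong) (simp_all add: sets_P[OF assms])
  let ?J = "\<lambda>\<omega> t. ennreal (exp (- l * t)) * occ (traj \<omega>) t ^ n * indicator {0..} t"
  have J: "(\<lambda>x. ?J (fst x) (snd x)) \<in> borel_measurable (P 0 \<Otimes>\<^sub>M lborel)"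
    unfolding measurable_cong_sets[OF sets_pair refl] using measurable_occ_path by measurable
  then have J': "(\<lambda>(\<omega>, t). ?J \<omega> t) \<in> borel_measurable (P 0 \<Otimes>\<^sub>M lborel)"
    by (simp add: split_beta')
  have inner: "(\<integral>\<^sup>+\<omega>. ?J \<omega> t \<partial>P 0)
      = ennreal (indicator {0..} t *\<^sub>R (exp (- l * t) * occupation_moment P X t n))" for t
  proof -
    have "(\<integral>\<^sup>+\<omega>. ?J \<omega> t \<partial>P 0) = (\<integral>\<^sup>+\<omega>. ennreal (exp (- l * t)) * indicator {0..} t * occ (traj \<omega>) t ^ n \<partial>P 0)"
      by (simp only: mult_ac)
    also have "\<dots> = ennreal (exp (- l * t)) * indicator {0..} t * (\<integral>\<^sup>+\<omega>. occ (traj \<omega>) t ^ n \<partial>P 0)"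
      unfolding measurable_P[OF assms] using measurable_occ_path_slice
      by (intro nn_integral_cmult) (simp add: measurable_P[OF assms])
    also have "\<dots> = ennreal (indicator {0..} t *\<^sub>R (exp (- l * t) * occupation_moment P X t n))"
      unfolding occupation_moment_eq[OF assms, symmetric]
      by (auto simp: ennreal_mult occupation_moment_nonneg split: split_indicator)
    finally show ?thesis .
  qed
  have "(\<lambda>t. \<integral>\<^sup>+\<omega>. ?J \<omega> t \<partial>P 0) \<in> borel_measurable lborel"
  proof (rule sigma_finite_measure.borel_measurable_nn_integral)
    show "sigma_finite_measure (P 0)" ..
    show "(\<lambda>(t, \<omega>). ?J \<omega> t) \<in> borel_measurable (lborel \<Otimes>\<^sub>M P 0)"
      using measurable_pair_swap[OF J'] by simp
  qed
  then have "(\<lambda>t. enn2real (\<integral>\<^sup>+\<omega>. ?J \<omega> t \<partial>P 0)) \<in> borel_measurable lborel"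
    by measurable
  then have "(\<lambda>t. indicator {0..} t *\<^sub>R (exp (- l * t) * occupation_moment P X t n)) \<in> borel_measurable lborel"
    unfolding inner by (simp add: occupation_moment_nonneg)
  then have "occupation_moment_laplace P X l n
      = enn2real (\<integral>\<^sup>+t. ennreal (indicator {0..} t *\<^sub>R (exp (- l * t) * occupation_moment P X t n)) \<partial>lborel)"
    unfolding occupation_moment_laplace_def set_lebesgue_integral_def
    by (intro integral_eq_nn_integral) (auto simp: occupation_moment_nonneg)
  also have "(\<integral>\<^sup>+t. ennreal (indicator {0..} t *\<^sub>R (exp (- l * t) * occupation_moment P X t n)) \<partial>lborel)
    = (\<integral>\<^sup>+t. \<integral>\<^sup>+\<omega>. ?J \<omega> t \<partial>P 0 \<partial>lborel)"
    by (simp only: inner)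
  also have "\<dots> = mean_occ_laplace l n 0"
    unfolding mean_occ_laplace_def occ_laplace_def by (rule Fubini'[OF J'])
  finally show ?thesis .
qed

end

section \<open>The recursion over the Green kernel\<close>

text \<open>
  The speed measure enters the recursion as the measure over which the density is integrated; being
  sigma-finite, it allows the exchange of the integrals over time and space.
\<close>
locale diffusion_with_density = regular_diffusion M F I P X
  for M :: "'w measure" and F I P X +
  fixes m :: "real measure" and p :: "real \<Rightarrow> real \<Rightarrow> real \<Rightarrow> real"
  assumes zero_in_I: "0 \<in> I"
    and sets_m: "sets m = sets borel"
    and sigma_finite_m: "sigma_finite_measure m"
    and density: "transition_density I P X m p"
begin

text \<open>The density from the starting point \<open>0\<close>, extended by \<open>0\<close> to a measurable function on the plane.\<close>
definition density0 :: "real \<Rightarrow> real \<Rightarrow> real" where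
  "density0 s y = (if 0 < s \<and> y \<in> I then p s 0 y else 0)"

definition green :: "real \<Rightarrow> real \<Rightarrow> ennreal" where
  "green l y = (\<integral>\<^sup>+s. ennreal (exp (- l * s) * density0 s y) \<partial>lborel)"

text \<open>
  The resolvent \<open>G\<^sub>\<lambda>\<close> applied to \<open>1\<^bsub>[0,\<infinity>)\<^esub> f\<close> at the point \<open>0\<close>.
\<close>
definition potential :: "real \<Rightarrow> (real \<Rightarrow> ennreal) \<Rightarrow> ennreal" where
  "potential l f = (\<integral>\<^sup>+y. green l y * (indicator (I \<inter> {0..}) y * f y) \<partial>m)"

lemma density0_nonneg: "0 \<le> density0 s y"
  using density zero_in_I unfolding transition_density_def density0_def by auto

lemma measurable_density0 [measurable]:
  "(\<lambda>x. density0 (fst x) (snd x)) \<in> borel_measurable (borel \<Otimes>\<^sub>M borel)"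
proof -
  let ?\<Omega> = "{0<..} \<times> I \<times> I :: (real \<times> real \<times> real) set"
  let ?q = "\<lambda>z. if z \<in> ?\<Omega> then (\<lambda>(t, x, y). p t x y) z else 0"
  have "?\<Omega> \<in> sets borel" by (intro borel_Times I_borel) simp
  then have "?q \<in> borel_measurable borel"
    using density unfolding transition_density_def by (subst measurable_restrict_space_iff[symmetric]) auto
  moreover have "(\<lambda>x. (fst x, 0, snd x)) \<in> borel \<Otimes>\<^sub>M borel \<rightarrow>\<^sub>M (borel :: (real \<times> real \<times> real) measure)"
    unfolding borel_prod[symmetric] by measurable
  ultimately have "(\<lambda>x. ?q (fst x, 0, snd x)) \<in> borel_measurable (borel \<Otimes>\<^sub>M borel)"
    by (rule measurable_compose[rotated])
  also have "(\<lambda>x. ?q (fst x, 0, snd x)) = (\<lambda>x. density0 (fst x) (snd x))"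
    using zero_in_I by (auto simp: density0_def fun_eq_iff)
  finally show ?thesis .
qed

lemma measurable_density0_slice [measurable]:
  "(\<lambda>s. density0 s y) \<in> borel_measurable borel" "(\<lambda>y. density0 s y) \<in> borel_measurable borel"
  using measurable_compose[OF _ measurable_density0, of "\<lambda>s. (s, y)" borel]
    measurable_compose[OF _ measurable_density0, of "\<lambda>y. (s, y)" borel] by simp_all

lemma measurable_green [measurable]: "green l \<in> borel_measurable borel"
proof -
  have "(\<lambda>x. density0 (snd x) (fst x)) \<in> borel_measurable (borel \<Otimes>\<^sub>M borel)"
    using measurable_compose[OF _ measurable_density0, of "\<lambda>x. (snd x, fst x)" "borel \<Otimes>\<^sub>M borel"] by simp
  then show ?thesis unfolding green_def by measurable
qed

lemma measurable_m: "measurable m N = measurable borel N"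
  by (rule measurable_cong_sets) (simp_all add: sets_m)

text \<open>Expectations under \<open>P y\<close> are measurable functions of \<open>y\<close> on \<open>I\<close> only; cut off, they are so on the line.\<close>
lemma measurable_extend:
  fixes f :: "real \<Rightarrow> ennreal"
  assumes "f \<in> borel_measurable (restrict_space borel I)"
  shows "(\<lambda>y. indicator (I \<inter> {0..}) y * f y) \<in> borel_measurable borel"
proof -
  have "(\<lambda>y. if y \<in> I then f y else 0) \<in> borel_measurable borel"
    using assms I_borel by (subst measurable_restrict_space_iff[symmetric]) auto
  then have "(\<lambda>y. indicator {0..} y * (if y \<in> I then f y else 0)) \<in> borel_measurable borel"
    by measurable
  also have "(\<lambda>y. indicator {0..} y * (if y \<in> I then f y else 0)) = (\<lambda>y. indicator (I \<inter> {0..}) y * f y)"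
    by (auto split: split_indicator)
  finally show ?thesis .
qed

lemma nn_integral_density0:
  assumes "0 < s" and f: "f \<in> borel_measurable (restrict_space borel I)"
  shows "(\<integral>\<^sup>+\<omega>. indicator {0..} (X s \<omega>) * f (X s \<omega>) \<partial>P 0)
    = (\<integral>\<^sup>+y. ennreal (density0 s y) * (indicator (I \<inter> {0..}) y * f y) \<partial>m)"
proof -
  note P0 = measurable_P[OF zero_in_I] space_P[OF zero_in_I] sets_P[OF zero_in_I]
  have Xs: "X s \<in> borel_measurable (P 0)" using measurable_X[of s] \<open>0 < s\<close> by (simp add: P0)
  have meas: "(\<lambda>y. ennreal (density0 s y)) \<in> borel_measurable m"
    unfolding measurable_m by measurable
  have "distr (P 0) borel (X s) = density m (\<lambda>y. ennreal (density0 s y))"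
  proof (rule measure_eqI)
    fix B assume "B \<in> sets (distr (P 0) borel (X s))"
    then have B: "B \<in> sets borel" by simp
    have "emeasure (distr (P 0) borel (X s)) B = emeasure (P 0) {\<omega> \<in> space (P 0). X s \<omega> \<in> B \<inter> I}"
      unfolding emeasure_distr[OF Xs B] using conservative \<open>0 < s\<close>
      by (intro arg_cong[where f = "emeasure (P 0)"]) (auto simp: P0)
    also have "\<dots> = (\<integral>\<^sup>+y\<in>B \<inter> I. ennreal (p s 0 y) \<partial>m)"
      using density \<open>0 < s\<close> zero_in_I B I_borel unfolding transition_density_def
      by (auto simp del: mem_Collect_eq Int_iff)
    also have "\<dots> = (\<integral>\<^sup>+y. ennreal (density0 s y) * indicator B y \<partial>m)"
      using \<open>0 < s\<close> by (intro nn_integral_cong) (auto simp: density0_def split: split_indicator)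
    also have "\<dots> = emeasure (density m (\<lambda>y. ennreal (density0 s y))) B"
      using B meas by (intro emeasure_density[symmetric]) (simp_all add: sets_m)
    finally show "emeasure (distr (P 0) borel (X s)) B = emeasure (density m (\<lambda>y. ennreal (density0 s y))) B" .
  qed (simp add: sets_m)
  note distr = this
  have "(\<integral>\<^sup>+\<omega>. indicator {0..} (X s \<omega>) * f (X s \<omega>) \<partial>P 0)
    = (\<integral>\<^sup>+\<omega>. indicator (I \<inter> {0..}) (X s \<omega>) * f (X s \<omega>) \<partial>P 0)"
    using conservative \<open>0 < s\<close> by (intro nn_integral_cong) (auto simp: P0 split: split_indicator)
  also have "\<dots> = (\<integral>\<^sup>+y. indicator (I \<inter> {0..}) y * f y \<partial>distr (P 0) borel (X s))"
    using measurable_extend[OF f] by (intro nn_integral_distr[OF Xs, symmetric]) simp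
  also have "\<dots> = (\<integral>\<^sup>+y. ennreal (density0 s y) * (indicator (I \<inter> {0..}) y * f y) \<partial>m)"
    unfolding distr using measurable_extend[OF f] meas by (intro nn_integral_density) (simp_all add: measurable_m)
  finally show ?thesis .
qed

text \<open>
  Apply the Markov property for each \<open>s\<close> in the pathwise recursion, write the expectation with the
  density of \<open>X\<^sub>s\<close> and integrate over \<open>s\<close> first. There is no density at time \<open>0\<close>, a null set of times.
\<close>
lemma mean_occ_laplace_Suc: "mean_occ_laplace l (Suc n) 0 = of_nat (Suc n) * potential l (mean_occ_laplace l n)"
proof -
  interpret prob_space "P 0" using zero_in_I by (rule prob_space_P)
  interpret P0: pair_sigma_finite "P 0" lborel ..
  interpret m: sigma_finite_measure m by (rule sigma_finite_m)
  interpret lm: pair_sigma_finite lborel m ..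
  note P0 = measurable_P[OF zero_in_I] space_P[OF zero_in_I] sets_P[OF zero_in_I]
  have sets_pair: "sets (P 0 \<Otimes>\<^sub>M lborel) = sets (M \<Otimes>\<^sub>M borel)"
    by (rule sets_pair_measure_cong) (simp_all add: P0)
  have sets_pair_m: "sets (lborel \<Otimes>\<^sub>M m) = sets (borel \<Otimes>\<^sub>M borel)"
    by (rule sets_pair_measure_cong) (simp_all add: sets_m)
  have path_shift: "(\<lambda>x. traj (fst (fst x)) (snd (fst x) + snd x)) \<in> borel_measurable ((M \<Otimes>\<^sub>M borel) \<Otimes>\<^sub>M borel)"
    using measurable_compose[OF _ measurable_traj, of "\<lambda>x. (fst (fst x), snd (fst x) + snd x)" "(M \<Otimes>\<^sub>M borel) \<Otimes>\<^sub>M borel"]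
    by simp
  have occ_laplace_shift: "(\<lambda>x. occ_laplace l n (\<lambda>u. traj (fst x) (snd x + u))) \<in> borel_measurable (M \<Otimes>\<^sub>M borel)"
    using measurable_occ_laplace_process[of "\<lambda>x u. traj (fst x) (snd x + u)", OF path_shift] .
  let ?h = "\<lambda>\<omega> s. ennreal (exp (- l * s)) * indicator {0..} s * indicator {0..} (traj \<omega> s)
      * occ_laplace l n (\<lambda>u. traj \<omega> (s + u))"
  have h: "(\<lambda>x. ?h (fst x) (snd x)) \<in> borel_measurable (M \<Otimes>\<^sub>M borel)"
    using occ_laplace_shift measurable_traj by measurable
  then have h': "(\<lambda>(\<omega>, s). ?h \<omega> s) \<in> borel_measurable (P 0 \<Otimes>\<^sub>M lborel)"
    unfolding measurable_cong_sets[OF sets_pair refl] by (simp add: split_beta')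
  have "mean_occ_laplace l (Suc n) 0 = (\<integral>\<^sup>+\<omega>. of_nat (Suc n) * (\<integral>\<^sup>+s. ?h \<omega> s \<partial>lborel) \<partial>P 0)"
    unfolding mean_occ_laplace_def by (simp only: occ_laplace_Suc[OF grid_limit_borel])
  also have "\<dots> = of_nat (Suc n) * (\<integral>\<^sup>+\<omega>. \<integral>\<^sup>+s. ?h \<omega> s \<partial>lborel \<partial>P 0)"
    using h unfolding P0 by (intro nn_integral_cmult) (simp add: P0)
  also have "(\<integral>\<^sup>+\<omega>. \<integral>\<^sup>+s. ?h \<omega> s \<partial>lborel \<partial>P 0) = (\<integral>\<^sup>+s. \<integral>\<^sup>+\<omega>. ?h \<omega> s \<partial>P 0 \<partial>lborel)"
    by (rule P0.Fubini'[OF h', symmetric])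
  also have "\<dots> = (\<integral>\<^sup>+s. \<integral>\<^sup>+y. ennreal (exp (- l * s) * density0 s y) * (indicator (I \<inter> {0..}) y * mean_occ_laplace l n y) \<partial>m \<partial>lborel)"
  proof (rule nn_integral_cong_AE)
    have "AE s in lborel. s \<noteq> (0::real)" by (rule AE_lborel_singleton)
    then show "AE s in lborel. (\<integral>\<^sup>+\<omega>. ?h \<omega> s \<partial>P 0)
      = (\<integral>\<^sup>+y. ennreal (exp (- l * s) * density0 s y) * (indicator (I \<inter> {0..}) y * mean_occ_laplace l n y) \<partial>m)"
    proof eventually_elim
      case (elim s)
      show ?case
      proof (cases "0 < s")
        case False
        then show ?thesis using elim by (simp add: density0_def)
      next
        case True
        have slice: "(\<lambda>\<omega>. indicator {0..} (X s \<omega>) * occ_laplace l n (\<lambda>u. traj \<omega> (s + u))) \<in> borel_measurable M"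
        proof -
          have "(\<lambda>\<omega>. occ_laplace l n (\<lambda>u. traj \<omega> (s + u))) \<in> borel_measurable M"
            using measurable_compose[OF _ occ_laplace_shift, of "\<lambda>\<omega>. (\<omega>, s)" M] by simp
          moreover have "X s \<in> borel_measurable M" using True by (intro measurable_X) simp
          ultimately show ?thesis by measurable
        qed
        have "(\<integral>\<^sup>+\<omega>. ?h \<omega> s \<partial>P 0)
          = (\<integral>\<^sup>+\<omega>. ennreal (exp (- l * s)) * (indicator {0..} (X s \<omega>) * occ_laplace l n (\<lambda>u. traj \<omega> (s + u))) \<partial>P 0)"
          using True by (intro nn_integral_cong) (simp add: P0 traj_eq mult.assoc)
        also have "\<dots> = ennreal (exp (- l * s)) * (\<integral>\<^sup>+\<omega>. indicator {0..} (X s \<omega>) * occ_laplace l n (\<lambda>u. traj \<omega> (s + u)) \<partial>P 0)"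
          using slice by (intro nn_integral_cmult) (simp only: P0)
        also have "\<dots> = ennreal (exp (- l * s)) * (\<integral>\<^sup>+y. ennreal (density0 s y) * (indicator (I \<inter> {0..}) y * mean_occ_laplace l n y) \<partial>m)"
          using True by (simp add: Markov_occ_laplace[OF zero_in_I] nn_integral_density0[OF True measurable_mean_occ_laplace])
        also have "\<dots> = (\<integral>\<^sup>+y. ennreal (exp (- l * s)) * (ennreal (density0 s y) * (indicator (I \<inter> {0..}) y * mean_occ_laplace l n y)) \<partial>m)"
          using measurable_extend[OF measurable_mean_occ_laplace, of l n]
          by (intro nn_integral_cmult[symmetric]) (simp add: measurable_m)
        also have "\<dots> = (\<integral>\<^sup>+y. ennreal (exp (- l * s) * density0 s y) * (indicator (I \<inter> {0..}) y * mean_occ_laplace l n y) \<partial>m)"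
          by (intro nn_integral_cong) (simp add: ennreal_mult density0_nonneg mult.assoc)
        finally show ?thesis .
      qed
    qed
  qed
  also have "\<dots> = (\<integral>\<^sup>+y. \<integral>\<^sup>+s. ennreal (exp (- l * s) * density0 s y) * (indicator (I \<inter> {0..}) y * mean_occ_laplace l n y) \<partial>lborel \<partial>m)"
  proof (rule lm.Fubini'[symmetric])
    have "(\<lambda>x. ennreal (exp (- l * fst x) * density0 (fst x) (snd x)) * (indicator (I \<inter> {0..}) (snd x) * mean_occ_laplace l n (snd x)))
      \<in> borel_measurable (borel \<Otimes>\<^sub>M borel)"
      using measurable_compose[OF measurable_snd measurable_extend[OF measurable_mean_occ_laplace[of l n]], of borel]
      by measurable
    then show "(\<lambda>(s, y). ennreal (exp (- l * s) * density0 s y) * (indicator (I \<inter> {0..}) y * mean_occ_laplace l n y))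
      \<in> borel_measurable (lborel \<Otimes>\<^sub>M m)"
      unfolding measurable_cong_sets[OF sets_pair_m refl] by (simp add: split_beta')
  qed
  also have "\<dots> = potential l (mean_occ_laplace l n)"
    unfolding potential_def green_def by (intro nn_integral_cong nn_integral_multc) measurable
  finally show ?thesis .
qed

lemma potential_cmult:
  assumes "f \<in> borel_measurable (restrict_space borel I)"
  shows "potential l (\<lambda>y. c * f y) = c * potential l f"
proof -
  have "potential l (\<lambda>y. c * f y) = (\<integral>\<^sup>+y. c * (green l y * (indicator (I \<inter> {0..}) y * f y)) \<partial>m)"
    unfolding potential_def by (simp only: mult_ac)
  also have "\<dots> = c * potential l f"
    unfolding potential_def using measurable_extend[OF assms]
    by (intro nn_integral_cmult) (simp add: measurable_m)
  finally show ?thesis .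
qed

lemma potential_add:
  assumes "f \<in> borel_measurable (restrict_space borel I)" "g \<in> borel_measurable (restrict_space borel I)"
  shows "potential l (\<lambda>y. f y + g y) = potential l f + potential l g"
  unfolding potential_def distrib_left using measurable_extend[OF assms(1)] measurable_extend[OF assms(2)]
  by (intro nn_integral_add) (simp_all add: measurable_m)

lemma potential_sum:
  assumes "\<And>j. j \<in> A \<Longrightarrow> f j \<in> borel_measurable (restrict_space borel I)"
  shows "potential l (\<lambda>y. \<Sum>j\<in>A. f j y) = (\<Sum>j\<in>A. potential l (f j))"
  unfolding potential_def sum_distrib_left using measurable_extend[OF assms]
  by (intro nn_integral_sum) (simp_all add: measurable_m)

lemma potential_cong: "(\<And>y. y \<in> I \<Longrightarrow> 0 \<le> y \<Longrightarrow> f y = g y) \<Longrightarrow> potential l f = potential l g"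
  unfolding potential_def by (intro nn_integral_cong) (auto split: split_indicator)

lemma potential_mono: "(\<And>y. y \<in> I \<Longrightarrow> 0 \<le> y \<Longrightarrow> f y \<le> g y) \<Longrightarrow> potential l f \<le> potential l g"
  unfolding potential_def by (rule nn_integral_mono) (auto split: split_indicator intro!: mult_left_mono)

lemma mean_occ_laplace_1:
  assumes "0 < l" shows "mean_occ_laplace l 1 0 = ennreal (1 / l) * potential l (\<lambda>_. 1)"
proof -
  have "mean_occ_laplace l 1 0 = potential l (mean_occ_laplace l 0)" using mean_occ_laplace_Suc[of l 0] by simp
  also have "\<dots> = potential l (\<lambda>y. ennreal (1 / l) * 1)"
    using mean_occ_laplace_0[OF assms] by (intro potential_cong) simp
  also have "\<dots> = ennreal (1 / l) * potential l (\<lambda>_. 1)"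
    by (rule potential_cmult) simp
  finally show ?thesis .
qed

text \<open>
  By the recursion for \<open>n = 0\<close>, the potential of \<open>1\<close> is \<open>\<lambda> E\<^sub>0 \<Psi>\<^sub>1\<close>, which is at most \<open>1/\<lambda>\<close> because \<open>A\<^sub>t \<le> t\<close>.
\<close>
lemma potential_finite:
  assumes "0 < l" and "\<And>y. y \<in> I \<Longrightarrow> f y \<le> ennreal c"
  shows "potential l f < top"
proof -
  have "mean_occ_laplace l 1 0 < top" using mean_occ_laplace_le[OF assms(1) zero_in_I, of 1] ennreal_less_top by (rule le_less_trans)
  moreover have "ennreal (1 / l) \<noteq> 0" using assms by simp
  ultimately have 1: "potential l (\<lambda>_. 1) < top"
    unfolding mean_occ_laplace_1[OF assms(1)] by (auto simp: ennreal_mult_less_top)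
  have "potential l f \<le> potential l (\<lambda>y. ennreal c * 1)"
    using assms(2) by (intro potential_mono) simp
  also have "\<dots> = ennreal c * potential l (\<lambda>_. 1)" by (rule potential_cmult) simp
  also have "\<dots> < top" using 1 by (simp add: ennreal_mult_less_top)
  finally show ?thesis .
qed

text \<open>Both sides are \<open>0\<close> where the integral over time diverges.\<close>
lemma green_kernel_eq:
  assumes "y \<in> I" shows "green_kernel p l 0 y = enn2real (green l y)"
proof -
  have "green_kernel p l 0 y = (\<integral>s. exp (- l * s) * density0 s y \<partial>lborel)"
    unfolding green_kernel_def set_lebesgue_integral_def
    using assms by (intro Bochner_Integration.integral_cong) (auto simp: density0_def split: split_indicator)
  also have "\<dots> = enn2real (green l y)"
    unfolding green_def by (intro integral_eq_nn_integral) (auto simp: density0_nonneg)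
  finally show ?thesis .
qed

text \<open>
  The real-valued Green kernel is \<open>0\<close> where the extended one is infinite. This happens only on a
  null set, since the potential of \<open>1\<close> is finite.
\<close>
lemma set_integral_green_kernel:
  assumes "0 < l" and f: "f \<in> borel_measurable (restrict_space borel I)"
    and fin: "\<And>y. y \<in> I \<Longrightarrow> f y < top"
  shows "(LINT y:I \<inter> {0..}|m. green_kernel p l 0 y * enn2real (f y)) = enn2real (potential l f)"
proof -
  have "potential l (\<lambda>_. 1) \<noteq> \<infinity>"
    using potential_finite[OF assms(1), of "\<lambda>_. 1" 1] by simp
  then have AE_fin: "AE y in m. green l y * (indicator (I \<inter> {0..}) y * 1) \<noteq> \<infinity>"
    unfolding potential_def using I_borel by (intro nn_integral_PInf_AE) (simp_all add: measurable_m)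
  let ?r = "\<lambda>y. enn2real (green l y) * enn2real (indicator (I \<inter> {0..}) y * f y)"
  have "(LINT y:I \<inter> {0..}|m. green_kernel p l 0 y * enn2real (f y)) = (\<integral>y. ?r y \<partial>m)"
    unfolding set_lebesgue_integral_def
    by (intro Bochner_Integration.integral_cong) (auto simp: green_kernel_eq split: split_indicator)
  also have "\<dots> = enn2real (\<integral>\<^sup>+y. ennreal (?r y) \<partial>m)"
    using measurable_extend[OF f] by (intro integral_eq_nn_integral) (simp_all add: measurable_m)
  also have "(\<integral>\<^sup>+y. ennreal (?r y) \<partial>m) = potential l f"
    unfolding potential_def
  proof (rule nn_integral_cong_AE)
    show "AE y in m. ennreal (?r y) = green l y * (indicator (I \<inter> {0..}) y * f y)"
      using AE_fin
    proof eventually_elim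
      case (elim y)
      show ?case
      proof (cases "y \<in> I \<inter> {0..}")
        case True
        then have "green l y < top" "f y < top" using elim fin[of y] by (auto simp: less_top)
        then show ?thesis using True by (simp add: ennreal_mult)
      qed simp
    qed
  qed
  finally show ?thesis .
qed

text \<open>The first passage identity, integrated against the Green kernel over the nonnegative part of \<open>I\<close>.\<close>
lemma potential_mean_occ_laplace:
  assumes l: "0 < l"
  shows "potential l (mean_occ_laplace l n) + (\<Sum>j\<le>n. of_nat (n choose j) * ennreal (fact j / l ^ (j + 1)) * potential l (hitting_moment l (n - j)))
    = ennreal (fact n / l ^ (n + 1)) * potential l (\<lambda>_. 1)
      + (\<Sum>j\<le>n. of_nat (n choose j) * mean_occ_laplace l j 0 * potential l (hitting_moment l (n - j)))"
proof -
  have cmult_meas: "(\<lambda>y. c * hitting_moment l k y) \<in> borel_measurable (restrict_space borel I)" for c k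
    using measurable_hitting_moment[of l k] by measurable
  have sum_meas: "(\<lambda>y. \<Sum>j\<le>n. c j * hitting_moment l (n - j) y) \<in> borel_measurable (restrict_space borel I)" for c
    by (rule borel_measurable_sum) (rule cmult_meas)
  have sum: "potential l (\<lambda>y. \<Sum>j\<le>n. c j * hitting_moment l (n - j) y)
      = (\<Sum>j\<le>n. c j * potential l (hitting_moment l (n - j)))" for c
    using potential_sum[of "{..n}" "\<lambda>j y. c j * hitting_moment l (n - j) y" l, OF cmult_meas]
    by (simp only: potential_cmult[OF measurable_hitting_moment])
  have "potential l (mean_occ_laplace l n) + (\<Sum>j\<le>n. of_nat (n choose j) * ennreal (fact j / l ^ (j + 1)) * potential l (hitting_moment l (n - j)))
    = potential l (\<lambda>y. mean_occ_laplace l n y + (\<Sum>j\<le>n. of_nat (n choose j) * ennreal (fact j / l ^ (j + 1)) * hitting_moment l (n - j) y))"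
    unfolding potential_add[OF measurable_mean_occ_laplace sum_meas] sum ..
  also have "\<dots> = potential l (\<lambda>y. ennreal (fact n / l ^ (n + 1)) * 1
      + (\<Sum>j\<le>n. of_nat (n choose j) * mean_occ_laplace l j 0 * hitting_moment l (n - j) y))"
  proof (rule potential_cong)
    fix y assume "y \<in> I" "0 \<le> y"
    from mean_occ_laplace_passage[OF l zero_in_I this, of n]
    show "mean_occ_laplace l n y + (\<Sum>j\<le>n. of_nat (n choose j) * ennreal (fact j / l ^ (j + 1)) * hitting_moment l (n - j) y)
      = ennreal (fact n / l ^ (n + 1)) * 1 + (\<Sum>j\<le>n. of_nat (n choose j) * mean_occ_laplace l j 0 * hitting_moment l (n - j) y)"
      by (simp only: mult_ac mult_1_left)
  qed
  also have "\<dots> = potential l (\<lambda>y. ennreal (fact n / l ^ (n + 1)) * 1)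
      + potential l (\<lambda>y. \<Sum>j\<le>n. of_nat (n choose j) * mean_occ_laplace l j 0 * hitting_moment l (n - j) y)"
    by (rule potential_add[OF _ sum_meas]) simp
  also have "potential l (\<lambda>y. ennreal (fact n / l ^ (n + 1)) * 1)
      = ennreal (fact n / l ^ (n + 1)) * potential l (\<lambda>_. 1)"
    by (rule potential_cmult) simp
  finally show ?thesis unfolding sum .
qed

end

section \<open>The recursion in real numbers\<close>

text \<open>
  Here \<open>a j = E\<^sub>0 \<Psi>\<^sub>j\<close>, \<open>d k\<close> is the potential of \<open>E\<^sub>y(e\<^sup>-\<^sup>\<lambda>\<^sup>H H\<^sup>k)\<close>, \<open>g\<close> the potential of \<open>1\<close> and \<open>b\<close> that of
  \<open>E\<^sub>y \<Psi>\<^sub>N\<close>. The term \<open>j = 0\<close> vanishes as \<open>a 0 = 1/l\<close>; the substitution \<open>k = n - j\<close> gives the sum in the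
  conclusion.
\<close>
lemma solve_moment_recurrence:
  fixes a d :: "nat \<Rightarrow> real" and b g l :: real
  assumes l: "0 < l" and a0: "a 0 = 1 / l" and aS: "a (Suc N) = real (Suc N) * b"
    and rec: "b + (\<Sum>j\<le>N. real (N choose j) * (fact j / l ^ (j + 1)) * d (N - j))
      = fact N / l ^ (N + 1) * g + (\<Sum>j\<le>N. real (N choose j) * a j * d (N - j))"
    and n: "n = Suc N"
  shows "a n = fact n / l ^ n * g + fact n / l ^ (n + 1) *
    (\<Sum>k = 1..n - 1. (1 - l ^ (n - k + 1) / fact (n - k) * a (n - k))
        * ((- l) ^ k / fact (k - 1) * ((- 1) ^ (k - 1) * d (k - 1))))"
proof -
  let ?t = "\<lambda>j. real (N choose j) * (fact j / l ^ (j + 1) - a j) * d (N - j)"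
  have "b = fact N / l ^ (N + 1) * g - (\<Sum>j\<le>N. ?t j)"
    using rec by (simp add: left_diff_distrib right_diff_distrib sum_subtractf)
  also have "(\<Sum>j\<le>N. ?t j) = (\<Sum>j\<in>{1..N}. ?t j)"
    using a0 by (intro sum.mono_neutral_right) (auto simp: not_le)
  also have "\<dots> = (\<Sum>k\<in>{1..N}. ?t (n - k))"
    by (rule sum.reindex_bij_witness[where i = "\<lambda>k. n - k" and j = "\<lambda>k. n - k"]) (auto simp: n)
  finally have b: "b = fact N / l ^ (N + 1) * g - (\<Sum>k\<in>{1..N}. ?t (n - k))" .
  have summand: "real n * ?t (n - k) = - (fact n / l ^ (n + 1) *
      ((1 - l ^ (n - k + 1) / fact (n - k) * a (n - k))
        * ((- l) ^ k / fact (k - 1) * ((- 1) ^ (k - 1) * d (k - 1)))))"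
    if k: "k \<in> {1..N}" for k
  proof -
    obtain i where i: "k = Suc i" using k by (cases k) auto
    define r where "r = N - i"
    have nk: "n - k = r" "N = r + i" "n = Suc (r + i)" "N - r = i" using k i by (auto simp: r_def n)
    have choose: "real (N choose r) = fact N / (fact r * fact i)"
      using binomial_fact[of r N, where 'a = real] nk by simp
    have sign: "(- l) ^ k * (- 1) ^ i = - (l ^ k)"
    proof -
      have "(- l) ^ k * (- 1) ^ i = - l * ((- l) * (- 1)) ^ i"
        unfolding i power_mult_distrib by (simp only: power_Suc mult_ac)
      then show ?thesis unfolding i by simp
    qed
    have "real n * ?t (n - k) = fact n / (fact r * fact i) * (fact r / l ^ (r + 1) - a r) * d i"
      unfolding nk(1) choose nk(4) by (simp add: n fact_Suc)
    also have "\<dots> = fact n / l ^ (n + 1) * ((1 - l ^ (r + 1) / fact r * a r) * (l ^ k / fact i * d i))"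
    proof -
      have pow: "l ^ (n + 1) = l ^ (r + 1) * l ^ k" unfolding nk(3) i by (simp add: power_add)
      have rearrange: "F / (u * v) * (u / A - x) * y = F / (A * B) * ((1 - A / u * x) * (B / v * y))"
        if "u \<noteq> 0" "v \<noteq> 0" "A \<noteq> 0" "B \<noteq> 0" for F u v A B x y :: real
        using that by (simp add: field_simps)
      show ?thesis unfolding pow using l by (intro rearrange) simp_all
    qed
    also have "\<dots> = - (fact n / l ^ (n + 1) * ((1 - l ^ (r + 1) / fact r * a r) * (((- l) ^ k * (- 1) ^ i) / fact i * d i)))"
      unfolding sign by simp
    finally have "real n * ?t (n - k) = - (fact n / l ^ (n + 1) *
      ((1 - l ^ (r + 1) / fact r * a r) * (((- l) ^ k * (- 1) ^ i) / fact i * d i)))" .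
    moreover have "k - 1 = i" using i by simp
    ultimately show ?thesis unfolding nk(1) by (simp add: mult_ac)
  qed
  have "a n = real n * (fact N / l ^ (N + 1) * g) - (\<Sum>k\<in>{1..N}. real n * ?t (n - k))"
    unfolding n aS b[unfolded n] by (simp only: right_diff_distrib sum_distrib_left)
  also have "(\<Sum>k\<in>{1..N}. real n * ?t (n - k)) = - (fact n / l ^ (n + 1) *
    (\<Sum>k\<in>{1..N}. (1 - l ^ (n - k + 1) / fact (n - k) * a (n - k))
        * ((- l) ^ k / fact (k - 1) * ((- 1) ^ (k - 1) * d (k - 1)))))"
    unfolding sum_distrib_left sum_negf[symmetric] by (rule sum.cong[OF refl summand])
  finally show ?thesis by (simp add: n fact_Suc)
qed

section \<open>The scaling property\<close>

lemma occ_scale: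
  assumes [measurable]: "w \<in> borel_measurable borel" and "0 < c"
  shows "ennreal c * occ (\<lambda>s. w (c * s)) 1 = occ w c"
proof -
  have "occ w c = ennreal \<bar>c\<bar> * (\<integral>\<^sup>+v. indicator {0..c} (0 + c * v) * indicator {0..} (w (0 + c * v)) \<partial>lborel)"
    unfolding occ_eq_nn_integral[OF assms(1)] using \<open>0 < c\<close> by (intro nn_integral_real_affine) auto
  also have "(\<integral>\<^sup>+v. indicator {0..c} (0 + c * v) * indicator {0..} (w (0 + c * v)) \<partial>lborel) = occ (\<lambda>s. w (c * s)) 1"
    using \<open>0 < c\<close> by (subst occ_eq_nn_integral) (auto intro!: nn_integral_cong split: split_indicator simp: zero_le_mult_iff)
  finally show ?thesis using \<open>0 < c\<close> by simp
qed

context regular_diffusion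
begin

text \<open>A process that rests at \<open>0\<close> does not reach another point of \<open>I\<close>, against regularity.\<close>
lemma not_AE_zero_path:
  assumes "0 \<in> I" and zero: "\<And>r. 0 \<le> r \<Longrightarrow> AE \<omega> in P 0. X r \<omega> = 0"
  shows False
proof -
  obtain y where y: "y \<in> I" "y \<noteq> 0" using exists_other_point by blast
  have "AE \<omega> in P 0. \<forall>r\<in>\<rat> \<inter> {0..}. X r \<omega> = 0"
    using zero countable_rat by (subst AE_ball_countable) (auto intro: countable_subset[of _ \<rat>])
  then have "AE \<omega> in P 0. \<not> hitting_time X y \<omega> < \<infinity>"
    using AE_space
  proof eventually_elim
    case (elim \<omega>)
    then have \<omega>: "\<omega> \<in> space M" using space_P[OF assms(1)] by simp
    have "X s \<omega> = 0" if "0 \<le> s" for s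
    proof -
      have "X (real i / real (Suc j)) \<omega> = 0" for i j using elim(1) by auto
      then have "traj \<omega> s = 0" by (simp add: grid_limit_def del: of_nat_Suc)
      then show ?thesis using traj_eq[OF \<omega> that] by simp
    qed
    then have "{ennreal t |t. 0 \<le> t \<and> X t \<omega> = y} = {}" using y(2) by auto
    then show ?case unfolding hitting_time_def by (simp only: Inf_empty) simp
  qed
  then have "emeasure (P 0) {\<omega> \<in> space (P 0). hitting_time X y \<omega> < \<infinity>} = 0"
    by (rule emeasure_eq_0_AE)
  then show False using regular[OF assms(1) y(1)] space_P[OF assms(1)] by simp
qed

text \<open>
  The scaling property for \<open>a = t\<close> gives a factor \<open>b\<close> such that \<open>(X\<^sub>t\<^sub>s)\<^sub>s\<close> and \<open>(b X\<^sub>s)\<^sub>s\<close> have the same law. If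
  \<open>b > 0\<close>, multiplication by \<open>b\<close> preserves the sign and \<open>A\<^sub>t\<close> has the law of \<open>t A\<^sub>1\<close>. The value \<open>b = 0\<close> is
  excluded, since then the process would rest at \<open>0\<close>.
\<close>
lemma occupation_moment_scaling:
  assumes "0 \<in> I" and "scaling_property P X" and "0 \<le> t"
  shows "occupation_moment P X t n = t ^ n * occupation_moment P X 1 n"
proof -
  interpret prob_space "P 0" using assms(1) by (rule prob_space_P)
  note P0 = measurable_P[OF assms(1)] space_P[OF assms(1)] sets_P[OF assms(1)]
  show ?thesis
  proof (cases "t = 0 \<or> n = 0")
    case True
    then consider "n = 0" | "t = 0" "0 < n" by blast
    then show ?thesis
    proof cases
      case 1
      then show ?thesis by (simp add: occupation_moment_def prob_space)
    next
      case 2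
      then have "occupation_time X t \<omega> = 0" if "\<omega> \<in> space M" for \<omega>
        using occ_le[of "traj \<omega>" 0] by (simp add: occupation_time_eq[OF that])
      then have "occupation_moment P X t n = (\<integral>\<omega>. 0 \<partial>P 0)"
        unfolding occupation_moment_def using 2 by (intro Bochner_Integration.integral_cong) (simp_all add: P0)
      then show ?thesis using 2 by simp
    qed
  next
    case False
    then have t: "0 < t" using assms(3) by simp
    let ?Y = "\<lambda>\<omega>. \<lambda>s\<in>{0..}. X (t * s) \<omega>"
    obtain b where b: "0 \<le> b" and eq: "distr (P 0) path_space ?Y = distr (P 0) path_space (\<lambda>\<omega>. \<lambda>s\<in>{0..}. b * X s \<omega>)"
      using assms(2,3) unfolding scaling_property_def by blast
    let ?Z = "\<lambda>\<omega>. \<lambda>s\<in>{0..}. b * X s \<omega>"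
    have Y: "?Y \<in> P 0 \<rightarrow>\<^sub>M path_space" and Z: "?Z \<in> P 0 \<rightarrow>\<^sub>M path_space"
      unfolding P0 path_space_def using measurable_X t
      by (auto intro!: measurable_restrict borel_measurable_times)
    have "b \<noteq> 0"
    proof
      assume "b = 0"
      have "AE \<omega> in P 0. X r \<omega> = 0" if "0 \<le> r" for r
      proof -
        have s: "0 \<le> r / t" using that t by simp
        have "(\<lambda>w. w (r / t)) \<in> borel_measurable path_space"
          unfolding path_space_def using s by (intro measurable_component_singleton) simp
        moreover have "Measurable.pred borel (\<lambda>x :: real. x = 0)" by measurable
        ultimately have [measurable]: "Measurable.pred path_space (\<lambda>w. w (r / t) = 0)"
          by (rule measurable_compose)
        have "AE w in distr (P 0) path_space ?Z. w (r / t) = 0"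
          using Z s \<open>b = 0\<close> by (subst AE_distr_iff) auto
        then have "AE \<omega> in P 0. ?Y \<omega> (r / t) = 0"
          unfolding eq[symmetric] using Y by (subst (asm) AE_distr_iff) auto
        then show ?thesis using s t by simp
      qed
      then show False by (rule not_AE_zero_path[OF assms(1)])
    qed
    with b have b: "0 < b" by simp
    let ?g = "\<lambda>w. (ennreal t * occ (grid_limit w) 1) ^ n"
    have g: "?g \<in> borel_measurable path_space"
    proof -
      have "(\<lambda>x. grid_limit (\<lambda>t. (fst x) t) (snd x)) \<in> borel_measurable (path_space \<Otimes>\<^sub>M borel)"
        by (rule measurable_grid_limit) (simp add: path_space_def)
      then have "(\<lambda>x. occ (grid_limit (fst x)) (snd x)) \<in> borel_measurable (path_space \<Otimes>\<^sub>M borel)"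
        by (intro measurable_occ_process) simp
      from measurable_compose[OF _ this, of "\<lambda>w. (w, 1)" path_space]
      have "(\<lambda>w. occ (grid_limit w) 1) \<in> borel_measurable path_space" by simp
      then show ?thesis by measurable
    qed
    have gY: "?g (?Y \<omega>) = occ (traj \<omega>) t ^ n" if \<omega>: "\<omega> \<in> space M" for \<omega>
    proof -
      have "continuous_on {0..} (\<lambda>s. X (t * s) \<omega>)"
        using t by (intro continuous_on_compose2[OF continuous_paths[OF \<omega>]] continuous_intros) auto
      then have "occ (grid_limit (?Y \<omega>)) 1 = occ (\<lambda>s. traj \<omega> (t * s)) 1"
        unfolding grid_limit_restrict using t by (intro occ_cong) (simp add: grid_limit_eq traj_eq[OF \<omega>])
      then show ?thesis using occ_scale[OF grid_limit_borel t] by simp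
    qed
    have gZ: "?g (?Z \<omega>) = ennreal (t ^ n) * occ (traj \<omega>) 1 ^ n" if \<omega>: "\<omega> \<in> space M" for \<omega>
    proof -
      have "continuous_on {0..} (\<lambda>s. b * X s \<omega>)"
        by (intro continuous_intros continuous_paths[OF \<omega>])
      then have "occ (grid_limit (?Z \<omega>)) 1 = occ (\<lambda>s. b * traj \<omega> s) 1"
        unfolding grid_limit_restrict by (intro occ_cong) (simp add: grid_limit_eq traj_eq[OF \<omega>])
      also have "\<dots> = occ (traj \<omega>) 1"
        unfolding occ_def using b by (simp add: zero_le_mult_iff)
      finally show ?thesis using t by (simp add: power_mult_distrib ennreal_power)
    qed
    have "ennreal (occupation_moment P X t n) = (\<integral>\<^sup>+\<omega>. ?g (?Y \<omega>) \<partial>P 0)"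
      unfolding occupation_moment_eq[OF assms(1)] by (intro nn_integral_cong) (simp only: gY P0)
    also have "\<dots> = (\<integral>\<^sup>+w. ?g w \<partial>distr (P 0) path_space ?Y)"
      by (rule nn_integral_distr[OF Y, symmetric]) (simp add: g)
    also have "\<dots> = (\<integral>\<^sup>+\<omega>. ?g (?Z \<omega>) \<partial>P 0)"
      unfolding eq by (rule nn_integral_distr[OF Z]) (simp add: g)
    also have "\<dots> = (\<integral>\<^sup>+\<omega>. ennreal (t ^ n) * occ (traj \<omega>) 1 ^ n \<partial>P 0)"
      by (intro nn_integral_cong) (simp only: gZ P0)
    also have "\<dots> = ennreal (t ^ n) * ennreal (occupation_moment P X 1 n)"
      unfolding occupation_moment_eq[OF assms(1)] using measurable_occ_path_slice[of 1]
      by (intro nn_integral_cmult) (simp add: P0)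
    also have "\<dots> = ennreal (t ^ n * occupation_moment P X 1 n)"
      using t by (simp add: ennreal_mult occupation_moment_nonneg)
    finally show ?thesis
      using t by (simp add: occupation_moment_nonneg)
  qed
qed

lemma occupation_moment_laplace_scaling:
  assumes "0 \<in> I" "scaling_property P X" "0 < l"
  shows "occupation_moment_laplace P X l n = fact n / l ^ (n + 1) * occupation_moment P X 1 n"
proof -
  have "occupation_moment_laplace P X l n
    = (\<integral>t. (t ^ n * exp (- l * t) * indicator {0..} t) * occupation_moment P X 1 n \<partial>lborel)"
    unfolding occupation_moment_laplace_def set_lebesgue_integral_def
  proof (rule Bochner_Integration.integral_cong[OF refl])
    fix t :: real
    show "indicator {0..} t *\<^sub>R (exp (- l * t) * occupation_moment P X t n)
      = t ^ n * exp (- l * t) * indicator {0..} t * occupation_moment P X 1 n"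
      by (cases "0 \<le> t") (simp_all add: occupation_moment_scaling[OF assms(1,2), of t])
  qed
  also have "\<dots> = (\<integral>t. t ^ n * exp (- l * t) * indicator {0..} t \<partial>lborel) * occupation_moment P X 1 n"
    by simp
  also have "(\<integral>t. t ^ n * exp (- l * t) * indicator {0..} t \<partial>lborel)
      = enn2real (\<integral>\<^sup>+t. ennreal (t ^ n * exp (- l * t) * indicator {0..} t) \<partial>lborel)"
    by (intro integral_eq_nn_integral) (auto split: split_indicator)
  also have "(\<integral>\<^sup>+t. ennreal (t ^ n * exp (- l * t) * indicator {0..} t) \<partial>lborel) = ennreal (fact n / l ^ (n + 1))"
    unfolding nn_integral_power_exp_Ici[OF assms(3), symmetric]
    by (intro nn_integral_cong) (auto split: split_indicator)
  finally show ?thesis using assms(3) by simp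
qed

end

section \<open>Recursive formulas for the moments\<close>

context diffusion_with_density
begin

lemma D_coeff_eq:
  assumes "0 < l"
  shows "D_coeff I P X m p k l = (- l) ^ k / fact (k - 1)
    * ((- 1) ^ (k - 1) * enn2real (potential l (hitting_moment l (k - 1))))"
proof -
  have "(LINT y:I \<inter> {0..}|m. green_kernel p l 0 y * (deriv ^^ (k - 1)) (hitting_laplace P X y) l)
    = (LINT y:I \<inter> {0..}|m. (- 1) ^ (k - 1) * (green_kernel p l 0 y * enn2real (hitting_moment l (k - 1) y)))"
    unfolding set_lebesgue_integral_def
    by (intro Bochner_Integration.integral_cong)
       (auto simp: higher_deriv_hitting_laplace assms hitting_moment_eq hitting_weight_nonneg split: split_indicator)
  also have "\<dots> = (- 1) ^ (k - 1) * enn2real (potential l (hitting_moment l (k - 1)))"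
    unfolding set_integral_mult_right
    by (subst set_integral_green_kernel[OF assms measurable_hitting_moment])
       (auto simp: hitting_moment_eq assms)
  finally show ?thesis unfolding D_coeff_def by simp
qed

lemma occupation_moment_laplace_recurrence:
  assumes l: "0 < l" and "1 \<le> n"
  shows "occupation_moment_laplace P X l n
    = fact n / l ^ n * (LINT y:I \<inter> {0..}|m. green_kernel p l 0 y)
      + fact n / l ^ (n + 1) *
        (\<Sum>k = 1..n - 1. (1 - l ^ (n - k + 1) / fact (n - k) * occupation_moment_laplace P X l (n - k))
           * D_coeff I P X m p k l)"
proof -
  define a where "a j = enn2real (mean_occ_laplace l j 0)" for j
  define d where "d k = enn2real (potential l (hitting_moment l k))" for k
  define g where "g = enn2real (potential l (\<lambda>_. 1))"
  obtain N where N: "n = Suc N" using \<open>1 \<le> n\<close> by (cases n) auto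
  define b where "b = enn2real (potential l (mean_occ_laplace l N))"
  have mean_occ_laplace_fin: "mean_occ_laplace l j x < top" if "x \<in> I" for j x
    using mean_occ_laplace_le[OF l that] ennreal_less_top by (rule le_less_trans)
  have a: "mean_occ_laplace l j 0 = ennreal (a j)" for j
    using mean_occ_laplace_fin[OF zero_in_I] by (simp add: a_def)
  have d: "potential l (hitting_moment l k) = ennreal (d k)" for k
    using potential_finite[OF l hitting_moment_le[OF l]] by (simp add: d_def)
  have g: "potential l (\<lambda>_. 1) = ennreal g"
    using potential_finite[OF l, of "\<lambda>_. 1" 1] by (simp add: g_def)
  have b: "potential l (mean_occ_laplace l N) = ennreal b"
    using potential_finite[OF l mean_occ_laplace_le[OF l]] by (simp add: b_def)
  have nonneg: "0 \<le> a j" "0 \<le> d j" "0 \<le> g" "0 \<le> b" for j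
    by (simp_all add: a_def d_def g_def b_def)
  define c where "c = fact N / l ^ (N + 1) * g"
  define T where "T j = real (N choose j) * (fact j / l ^ (j + 1)) * d (N - j)" for j
  define U where "U j = real (N choose j) * a j * d (N - j)" for j
  have c: "ennreal (fact N / l ^ (N + 1)) * ennreal g = ennreal c" and "0 \<le> c"
    unfolding c_def using nonneg l by (simp_all add: ennreal_mult[symmetric])
  have T: "of_nat (N choose j) * ennreal (fact j / l ^ (j + 1)) * ennreal (d (N - j)) = ennreal (T j)" and "0 \<le> T j" for j
    unfolding T_def using nonneg l by (simp_all add: ennreal_mult ennreal_of_nat_eq_real_of_nat del: times_divide_eq_right)
  have U: "of_nat (N choose j) * ennreal (a j) * ennreal (d (N - j)) = ennreal (U j)" and "0 \<le> U j" for j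
    unfolding U_def using nonneg l by (simp_all add: ennreal_mult ennreal_of_nat_eq_real_of_nat)
  have "ennreal b + (\<Sum>j\<le>N. ennreal (T j)) = ennreal c + (\<Sum>j\<le>N. ennreal (U j))"
    using potential_mean_occ_laplace[OF l, of N] unfolding a b d g c T U .
  then have "ennreal (b + (\<Sum>j\<le>N. T j)) = ennreal (c + (\<Sum>j\<le>N. U j))"
    using nonneg \<open>0 \<le> c\<close> \<open>\<And>j. 0 \<le> T j\<close> \<open>\<And>j. 0 \<le> U j\<close> by (simp add: sum_nonneg)
  then have "b + (\<Sum>j\<le>N. T j) = c + (\<Sum>j\<le>N. U j)"
    using nonneg \<open>0 \<le> c\<close> \<open>\<And>j. 0 \<le> T j\<close> \<open>\<And>j. 0 \<le> U j\<close>
    by (subst (asm) ennreal_inj) (auto intro!: add_nonneg_nonneg sum_nonneg)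
  then have rec: "b + (\<Sum>j\<le>N. real (N choose j) * (fact j / l ^ (j + 1)) * d (N - j))
      = fact N / l ^ (N + 1) * g + (\<Sum>j\<le>N. real (N choose j) * a j * d (N - j))"
    unfolding c_def T_def U_def .
  have aS: "a (Suc N) = real (Suc N) * b"
    unfolding a_def mean_occ_laplace_Suc b using nonneg by (simp add: enn2real_mult del: of_nat_Suc)
  have a0: "a 0 = 1 / l" using l by (simp add: a_def mean_occ_laplace_0[OF l zero_in_I])
  have LINT: "(LINT y:I \<inter> {0..}|m. green_kernel p l 0 y) = g"
    using set_integral_green_kernel[OF l, of "\<lambda>_. 1"] by (simp add: g_def)
  show ?thesis
    using solve_moment_recurrence[where d = d, OF l a0 aS rec N]
    unfolding LINT D_coeff_eq[OF l] occupation_moment_laplace_eq[OF zero_in_I] a_def[symmetric] d_def[symmetric] .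
qed

lemma occupation_moment_laplace_1:
  assumes "0 < l"
  shows "occupation_moment_laplace P X l 1 = 1 / l * (LINT y:I \<inter> {0..}|m. green_kernel p l 0 y)"
  using occupation_moment_laplace_recurrence[OF assms, of 1] by simp

end

theorem theorem5p1:
  fixes M :: "'w measure"
    and F :: "ennreal \<Rightarrow> 'w measure"
    and I :: "real set"
    and P :: "real \<Rightarrow> 'w measure"
    and X :: "real \<Rightarrow> 'w \<Rightarrow> real"
    and S :: "real \<Rightarrow> real"
    and m :: "real measure"
    and p :: "real \<Rightarrow> real \<Rightarrow> real \<Rightarrow> real"
  assumes "regular_diffusion M F I P X"
    and "0 \<in> I"
    and "scale_function I P X S" and "S 0 = 0"
    and "speed_measure I P X S m"
    and "transition_density I P X m p"
  shows "(\<forall>lam>0.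
      occupation_moment_laplace P X lam 1
        = 1 / lam * (LINT y:I \<inter> {0..}|m. green_kernel p lam 0 y)
      \<and> (\<forall>n\<ge>2. occupation_moment_laplace P X lam n
          = fact n / lam ^ (n - 1) * occupation_moment_laplace P X lam 1
            + fact n / lam ^ (n + 1) *
              (\<Sum>k = 1..n - 1.
                 (1 - lam ^ (n - k + 1) / fact (n - k) * occupation_moment_laplace P X lam (n - k))
                 * D_coeff I P X m p k lam)))
    \<and> (scaling_property P X \<longrightarrow>
        (\<forall>lam>0. occupation_moment P X 1 1
            = lam * (LINT y:I \<inter> {0..}|m. green_kernel p lam 0 y))
        \<and> (\<forall>n\<ge>1. \<forall>lam>0. occupation_moment P X 1 n
            = occupation_moment P X 1 1
              + (\<Sum>k = 1..n - 1.
                   (1 - occupation_moment P X 1 (n - k)) * D_coeff I P X m p k lam)))"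
proof -
  interpret regular_diffusion M F I P X by fact
  interpret diffusion_with_density M F I P X m p
  proof (intro diffusion_with_density.intro diffusion_with_density_axioms.intro)
    show "sets m = sets borel" using assms(5) by (simp add: speed_measure_def)
    show "sigma_finite_measure m" using assms(5) by (rule sigma_finite_speed_measure)
  qed fact+
  note recurrence = occupation_moment_laplace_recurrence
  note first = occupation_moment_laplace_1
  note scaling = occupation_moment_laplace_scaling[OF \<open>0 \<in> I\<close>]
  have higher: "occupation_moment_laplace P X lam n
          = fact n / lam ^ (n - 1) * occupation_moment_laplace P X lam 1
            + fact n / lam ^ (n + 1) *
              (\<Sum>k = 1..n - 1.
                 (1 - lam ^ (n - k + 1) / fact (n - k) * occupation_moment_laplace P X lam (n - k))
                 * D_coeff I P X m p k lam)" if "0 < lam" "2 \<le> n" for lam n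
  proof -
    have "lam ^ n = lam ^ (n - 1) * lam" using \<open>2 \<le> n\<close> by (simp add: power_eq_if)
    then show ?thesis using recurrence[OF \<open>0 < lam\<close>, of n] that unfolding first[OF \<open>0 < lam\<close>] by simp
  qed
  have scaled_1: "occupation_moment P X 1 1 = lam * (LINT y:I \<inter> {0..}|m. green_kernel p lam 0 y)"
    if "scaling_property P X" "0 < lam" for lam
    using first[OF that(2)] scaling[OF that, of 1] that(2) by (simp add: field_simps power2_eq_square)
  have scaled: "occupation_moment P X 1 n = occupation_moment P X 1 1
              + (\<Sum>k = 1..n - 1. (1 - occupation_moment P X 1 (n - k)) * D_coeff I P X m p k lam)"
    if "scaling_property P X" "0 < lam" "1 \<le> n" for lam n
  proof -
    let ?S = "\<Sum>k = 1..n - 1. (1 - occupation_moment P X 1 (n - k)) * D_coeff I P X m p k lam"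
    have "lam ^ (n - k + 1) / fact (n - k) * occupation_moment_laplace P X lam (n - k)
        = occupation_moment P X 1 (n - k)" for k
      unfolding scaling[OF that(1,2)] using that(2) by simp
    then have "fact n / lam ^ (n + 1) * occupation_moment P X 1 n
      = fact n / lam ^ n * (LINT y:I \<inter> {0..}|m. green_kernel p lam 0 y) + fact n / lam ^ (n + 1) * ?S"
      using recurrence[OF that(2,3)] scaling[OF that(1,2), of n] by simp
    also have "\<dots> = fact n / lam ^ (n + 1) * (occupation_moment P X 1 1 + ?S)"
      unfolding scaled_1[OF that(1,2)] using that(2) by (simp add: distrib_left)
    finally show ?thesis using that(2) by simp
  qed
  show ?thesis using first higher scaled_1 scaled by blast
qed

end
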